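(* Let $n\ge 1$. If $Z\colon \mathrm{Conv}(\mathbb{R}^n;\mathbb{R})\to\mathbb{R}$ is a continuous and dually epi-translation invariant valuation, then there are continuous and dually epi-translation invariant valuations $Z_0,\dots,Z_n\colon \mathrm{Conv}(\mathbb{R}^n;\mathbb{R})\to\mathbb{R}$ such that $Z_i$ is homogeneous of degree $i$ for each $i\in\{0,\dots,n\}$ and $Z=Z_0+\dots+Z_n$.
   Context: $\mathrm{Conv}(\mathbb{R}^n;\mathbb{R})$ is the set of convex functions $v\colon\mathbb{R}^n\to\mathbb{R}$ (finite everywhere). Topology: continuity is with respect to epi-convergence. A sequence $v_k$ epi-converges to $v$ if for every $x\in\mathbb{R}^n$: (i) $v(x)\le\liminf_{k\to\infty}v_k(x_k)$ for every sequence $x_k\to x$, and (ii) there is a sequence $x_k\to x$ with $v(x)=\lim_{k\to\infty}v_k(x_k)$. (On $\mathrm{Conv}(\mathbb{R}^n;\mathbb{R})$ this is equivalent to uniform convergence on compact sets.) A functional $Z\colon X\to\mathbb{R}$ on a set $X$ of functions is a valuation if $Z(u\vee v)+Z(u\wedge v)=Z(u)+Z(v)$ for all $u,v\in X$ with $u\vee v\in X$ and $u\wedge v\in X$, where $\vee$ and $\wedge$ denote pointwise maximum and minimum. $Z$ is dually epi-translation invariant if $Z(v+\ell)=Z(v)$ for every $v$ and every linear function $\ell\colon\mathbb{R}^n\to\mathbb{R}$ (dual translation invariance) and $Z(v+\alpha)=Z(v)$ for every $v$ and every constant $\alpha\in\mathbb{R}$ (vertical translation invariance). $Z$ is homogeneous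 of degree $\alpha$ if $Z(\lambda v)=\lambda^\alpha Z(v)$ for all $v\in\mathrm{Conv}(\mathbb{R}^n;\mathbb{R})$ and $\lambda\ge 0$ (with $0^0=1$). *)

theory Defs
  imports "HOL-Analysis.Analysis"
begin

text \<open>
  Functionals on \<open>Conv\<close> are represented by total functionals on all functions
  \<open>'a \<Rightarrow> real\<close>; every notion below only constrains their values on \<open>Conv\<close>.
\<close>

definition Conv :: "('a::euclidean_space \<Rightarrow> real) set" where
  "Conv = {v. convex_on UNIV v}"

text \<open>The lower limit is taken in the extended reals, since the sequence need not be bounded.\<close>

definition epi_converges ::
    "(nat \<Rightarrow> 'a::euclidean_space \<Rightarrow> real) \<Rightarrow> ('a \<Rightarrow> real) \<Rightarrow> bool" where
  "epi_converges vs v \<longleftrightarrow>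
     (\<forall>x. (\<forall>xs. xs \<longlonglongrightarrow> x \<longrightarrow> ereal (v x) \<le> liminf (\<lambda>k. ereal (vs k (xs k)))) \<and>
          (\<exists>xs. xs \<longlonglongrightarrow> x \<and> (\<lambda>k. vs k (xs k)) \<longlonglongrightarrow> v x))"

definition epi_continuous :: "(('a::euclidean_space \<Rightarrow> real) \<Rightarrow> real) \<Rightarrow> bool" where
  "epi_continuous Z \<longleftrightarrow>
     (\<forall>vs. \<forall>v\<in>Conv. (\<forall>k. vs k \<in> Conv) \<longrightarrow> epi_converges vs v \<longrightarrow> (\<lambda>k. Z (vs k)) \<longlonglongrightarrow> Z v)"

definition valuation_on :: "('a \<Rightarrow> real) set \<Rightarrow> (('a \<Rightarrow> real) \<Rightarrow> real) \<Rightarrow> bool" where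
  "valuation_on X Z \<longleftrightarrow>
     (\<forall>u\<in>X. \<forall>v\<in>X. (\<lambda>x. max (u x) (v x)) \<in> X \<longrightarrow> (\<lambda>x. min (u x) (v x)) \<in> X \<longrightarrow>
        Z (\<lambda>x. max (u x) (v x)) + Z (\<lambda>x. min (u x) (v x)) = Z u + Z v)"

definition dually_translation_invariant ::
    "(('a::euclidean_space \<Rightarrow> real) \<Rightarrow> real) \<Rightarrow> bool" where
  "dually_translation_invariant Z \<longleftrightarrow>
     (\<forall>v\<in>Conv. \<forall>l. linear l \<longrightarrow> Z (\<lambda>x. v x + l x) = Z v)"

definition vertically_translation_invariant ::
    "(('a::euclidean_space \<Rightarrow> real) \<Rightarrow> real) \<Rightarrow> bool" where
  "vertically_translation_invariant Z \<longleftrightarrow>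
     (\<forall>v\<in>Conv. \<forall>\<alpha>::real. Z (\<lambda>x. v x + \<alpha>) = Z v)"

definition dually_epi_translation_invariant ::
    "(('a::euclidean_space \<Rightarrow> real) \<Rightarrow> real) \<Rightarrow> bool" where
  "dually_epi_translation_invariant Z \<longleftrightarrow>
     dually_translation_invariant Z \<and> vertically_translation_invariant Z"

text \<open>
  Only natural degrees are needed. The power with natural exponent satisfies \<open>0 ^ 0 = 1\<close>,
  as the definition requires (whereas \<open>0 powr 0 = 0\<close>).
\<close>

definition homogeneous_of_degree ::
    "nat \<Rightarrow> (('a::euclidean_space \<Rightarrow> real) \<Rightarrow> real) \<Rightarrow> bool" where
  "homogeneous_of_degree i Z \<longleftrightarrow>
     (\<forall>v\<in>Conv. \<forall>c::real. 0 \<le> c \<longrightarrow> Z (\<lambda>x. c * v x) = c ^ i * Z v)"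

end

theory Submission
  imports Defs "HOL-Probability.Probability" "HOL-Real_Asymp.Real_Asymp"
begin

text \<open>
  It suffices that \<open>t \<mapsto> Z (t v)\<close> is polynomial of degree at most \<open>n\<close> on \<open>t \<ge> 0\<close>: by
  interpolation its coefficients are linear combinations of \<open>Z (0 v), \<dots>, Z (n v)\<close>. By continuity
  this follows once all \<open>(n + 1)\<close>-fold differences
  \<open>D\<^sub>w Z (u) = Z (u + w) - Z u\<close> of \<open>Z\<close> along convex functions vanish.

  Along hinges \<open>max 0 (a \<bullet> x - \<alpha>)\<close>, the valuation property shows that \<open>D\<^sub>w Z (u)\<close> depends only
  on the restriction of \<open>u\<close> to the hyperplane where the hinge has its kink. After \<open>k\<close> differences
  in independent directions only a subspace of dimension \<open>n - k\<close> matters, and a hinge which is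
  constant there gives difference zero.

  To pass from hinges to all convex functions, let \<open>Y\<close> be invariant under adding hinges. Then \<open>Y\<close> is
  invariant under adding limits of sums of hinges, in particular convex ridge functions
  \<open>\<phi> (a \<bullet> x)\<close>, and under adding any convex \<open>v\<close> such that both \<open>w\<close> and \<open>v + w\<close> are such
  limits. Averages of cosines show that a Gaussian plus a square norm is such a limit. Hence so
  are, after adding a suitable \<open>w\<close>, the Gaussian convolutions of convex functions of the form
  \<open>C |x|\<^sub>1 - D + f\<close> with \<open>f\<close> nonnegative of compact support, and these are dense.
\<close>

section \<open>Convex functions and epi-convergence\<close>

lemma Conv_iff:
  "v \<in> Conv \<longleftrightarrow>
     (\<forall>x y t. 0 \<le> t \<longrightarrow> t \<le> 1 \<longrightarrow> v ((1 - t) *\<^sub>R x + t *\<^sub>R y) \<le> (1 - t) * v x + t * v y)"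
proof
  assume "v \<in> Conv"
  then show "\<forall>x y t. 0 \<le> t \<longrightarrow> t \<le> 1 \<longrightarrow>
      v ((1 - t) *\<^sub>R x + t *\<^sub>R y) \<le> (1 - t) * v x + t * v y"
    unfolding Conv_def by (auto intro: convex_onD)
next
  assume *: "\<forall>x y t. 0 \<le> t \<longrightarrow> t \<le> 1 \<longrightarrow>
      v ((1 - t) *\<^sub>R x + t *\<^sub>R y) \<le> (1 - t) * v x + t * v y"
  show "v \<in> Conv"
    unfolding Conv_def by (auto intro!: convex_onI simp: *)
qed

lemma ConvD:
  assumes "v \<in> Conv" "0 \<le> t" "t \<le> 1"
  shows "v ((1 - t) *\<^sub>R x + t *\<^sub>R y) \<le> (1 - t) * v x + t * v y"
  using assms Conv_iff by blast

lemma ConvI: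
  assumes "\<And>x y t. 0 \<le> t \<Longrightarrow> t \<le> 1 \<Longrightarrow>
    v ((1 - t) *\<^sub>R x + t *\<^sub>R y) \<le> (1 - t) * v x + t * v y"
  shows "v \<in> Conv"
  using assms Conv_iff by blast

lemma Conv_add: "u \<in> Conv \<Longrightarrow> v \<in> Conv \<Longrightarrow> (\<lambda>x. u x + v x) \<in> Conv"
  unfolding Conv_def by (auto intro: convex_on_add)

lemma Conv_cmul: "0 \<le> c \<Longrightarrow> u \<in> Conv \<Longrightarrow> (\<lambda>x. c * u x) \<in> Conv"
  unfolding Conv_def by (auto intro: convex_on_cmul)

lemma Conv_const: "(\<lambda>x. c) \<in> Conv"
  by (rule ConvI) (simp add: algebra_simps)

lemma Conv_linear: "linear l \<Longrightarrow> l \<in> Conv"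
  by (rule ConvI) (simp add: linear_add linear_cmul)

lemma Conv_inner: "(\<lambda>x. a \<bullet> x) \<in> Conv"
  by (rule Conv_linear) (simp add: bounded_linear.linear bounded_linear_inner_right)

lemma Conv_inner_add: "u \<in> Conv \<Longrightarrow> (\<lambda>x. u x + a \<bullet> x + c) \<in> Conv"
  by (intro Conv_add Conv_inner Conv_const)

lemma Conv_sum:
  "finite I \<Longrightarrow> (\<And>i. i \<in> I \<Longrightarrow> f i \<in> Conv) \<Longrightarrow> (\<lambda>x. \<Sum>i\<in>I. f i x) \<in> Conv"
  by (induction I rule: finite_induct) (auto intro: Conv_const Conv_add)

lemma Conv_max:
  assumes "u \<in> Conv" "v \<in> Conv"
  shows "(\<lambda>x. max (u x) (v x)) \<in> Conv"
proof (rule ConvI)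
  fix x y :: 'a and t :: real
  assume t: "0 \<le> t" "t \<le> 1"
  have "(1 - t) * u x + t * u y \<le> (1 - t) * max (u x) (v x) + t * max (u y) (v y)"
    "(1 - t) * v x + t * v y \<le> (1 - t) * max (u x) (v x) + t * max (u y) (v y)"
    using t by (auto intro!: add_mono mult_left_mono)
  with ConvD[OF assms(1) t, of x y] ConvD[OF assms(2) t, of x y]
  show "max (u ((1 - t) *\<^sub>R x + t *\<^sub>R y)) (v ((1 - t) *\<^sub>R x + t *\<^sub>R y))
      \<le> (1 - t) * max (u x) (v x) + t * max (u y) (v y)"
    by linarith
qed

lemma Conv_comp_affine:
  assumes "v \<in> Conv" "linear A"
  shows "(\<lambda>x. v (A x + b)) \<in> Conv"
proof (rule ConvI)
  fix x y :: 'b and t :: real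
  assume t: "0 \<le> t" "t \<le> 1"
  have "A ((1 - t) *\<^sub>R x + t *\<^sub>R y) + b = (1 - t) *\<^sub>R (A x + b) + t *\<^sub>R (A y + b)"
    by (simp only: linear_add[OF assms(2)] linear_cmul[OF assms(2)]) (simp add: algebra_simps)
  with ConvD[OF assms(1) t] show
    "v (A ((1 - t) *\<^sub>R x + t *\<^sub>R y) + b) \<le> (1 - t) * v (A x + b) + t * v (A y + b)"
    by metis
qed

lemma Conv_isCont:
  assumes "v \<in> Conv"
  shows "isCont v x"
  using convex_on_continuous[of UNIV v] assms
  by (auto simp: Conv_def continuous_on_eq_continuous_at)

lemma Conv_continuous_on: "v \<in> Conv \<Longrightarrow> continuous_on S v"
  by (simp add: Conv_isCont continuous_at_imp_continuous_on)

lemma Conv_borel_measurable [measurable]: "v \<in> Conv \<Longrightarrow> v \<in> borel_measurable borel"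
  by (intro borel_measurable_continuous_onI Conv_continuous_on)

lemma Conv_pointwise_limit:
  assumes "\<And>k::nat. vs k \<in> Conv" "\<And>x. (\<lambda>k. vs k x) \<longlonglongrightarrow> v x"
  shows "v \<in> Conv"
proof (rule ConvI)
  fix x y :: 'a and t :: real
  assume t: "0 \<le> t" "t \<le> 1"
  show "v ((1 - t) *\<^sub>R x + t *\<^sub>R y) \<le> (1 - t) * v x + t * v y"
    using ConvD[OF assms(1) t]
    by (intro LIMSEQ_le[OF assms(2)
        tendsto_add[OF tendsto_mult_left[OF assms(2)] tendsto_mult_left[OF assms(2)]]]) blast
qed

text \<open>A neighbourhood of \<open>x\<close> is the convex hull of finitely many points near \<open>x\<close>,
  so pointwise upper bounds at these points are locally uniform.\<close>

lemma Conv_pointwise_eventually_less: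
  fixes v :: "'a::euclidean_space \<Rightarrow> real"
  assumes vs: "\<And>k::nat. vs k \<in> Conv" and lim: "\<And>x. (\<lambda>k. vs k x) \<longlonglongrightarrow> v x"
    and xs: "xs \<longlonglongrightarrow> x" and less: "v x < c"
  shows "eventually (\<lambda>k. vs k (xs k) < c) sequentially"
proof -
  have v: "v \<in> Conv"
    using vs lim by (rule Conv_pointwise_limit)
  have "open {y. v y < c}"
    using Conv_continuous_on[OF v, of UNIV] by (intro open_Collect_less) auto
  with less obtain e where e: "e > 0" "ball x e \<subseteq> {y. v y < c}"
    by (metis mem_Collect_eq open_contains_ball)
  \<comment> \<open>The cube of half-width \<open>d\<close> has Euclidean radius at most
    \<open>DIM('a) * d = e / 2\<close>, so it stays inside the ball.\<close>
  define d where "d = e / (2 * DIM('a))"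
  have d: "d > 0"
    using e by (simp add: d_def)
  obtain S :: "'a set" where S: "finite S"
    "cbox (x - (\<Sum>i\<in>Basis. d *\<^sub>R i)) (x + (\<Sum>i\<in>Basis. d *\<^sub>R i)) = convex hull S"
    using cube_convex_hull[OF d] by blast
  have cube: "y \<in> cbox (x - (\<Sum>i\<in>Basis. d *\<^sub>R i)) (x + (\<Sum>i\<in>Basis. d *\<^sub>R i)) \<longleftrightarrow>
      (\<forall>i\<in>Basis. \<bar>(y - x) \<bullet> i\<bar> \<le> d)" for y
    by (auto simp: mem_box algebra_simps abs_le_iff)
  have "S \<subseteq> ball x e"
  proof
    fix y assume "y \<in> S"
    then have "y \<in> convex hull S"
      by (rule hull_inc)
    then have "\<forall>i\<in>Basis. \<bar>(y - x) \<bullet> i\<bar> \<le> d"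
      using S(2) cube by blast
    then have "norm (y - x) \<le> (\<Sum>i\<in>(Basis::'a set). d)"
      by (intro order_trans[OF norm_le_l1] sum_mono) auto
    also have "\<dots> < e"
      using e by (simp add: d_def)
    finally show "y \<in> ball x e"
      by (simp add: dist_norm norm_minus_commute)
  qed
  then have "\<forall>y\<in>S. v y < c"
    using e by blast
  then have "\<forall>y\<in>S. eventually (\<lambda>k. vs k y < c) sequentially"
    using lim order_tendstoD(2) by blast
  then have ev1: "eventually (\<lambda>k. \<forall>y\<in>S. vs k y < c) sequentially"
    using S(1) by (simp add: eventually_ball_finite)
  have ev2: "eventually (\<lambda>k. dist (xs k) x < d) sequentially"
    using xs d by (rule tendstoD)
  show ?thesis
    using ev1 ev2
  proof eventually_elim
    case (elim k)
    have "\<bar>(xs k - x) \<bullet> i\<bar> \<le> d" if "i \<in> Basis" for i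
      using Basis_le_norm[OF that, of "xs k - x"] elim(2) by (simp add: dist_norm)
    then have mem: "xs k \<in> convex hull S"
      using S(2) cube by blast
    then have "S \<noteq> {}"
      by auto
    have "convex_on (convex hull S) (vs k)"
      using vs[of k] by (auto simp: Conv_def intro: convex_on_subset)
    moreover have "\<forall>y\<in>S. vs k y \<le> Max (vs k ` S)"
      using S(1) by auto
    ultimately have "vs k (xs k) \<le> Max (vs k ` S)"
      using convex_on_convex_hull_bound mem by blast
    also have "\<dots> < c"
      using elim(1) S(1) \<open>S \<noteq> {}\<close> by simp
    finally show ?case .
  qed
qed

section \<open>Epi-convergence and pointwise convergence\<close>

text \<open>Unfolds the extended-real lower limit into eventual strict inequalities between reals,
  the form used in the lemmas below.\<close>

lemma epi_converges_alt:
  "epi_converges vs v \<longleftrightarrow>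
     (\<forall>x. (\<forall>xs. xs \<longlonglongrightarrow> x \<longrightarrow> (\<forall>c<v x. eventually (\<lambda>k. c < vs k (xs k)) sequentially)) \<and>
          (\<exists>xs. xs \<longlonglongrightarrow> x \<and> (\<lambda>k. vs k (xs k)) \<longlonglongrightarrow> v x))"
proof -
  have "ereal (v x) \<le> liminf (\<lambda>k. ereal (vs k (xs k))) \<longleftrightarrow>
      (\<forall>c<v x. eventually (\<lambda>k. c < vs k (xs k)) sequentially)" for x xs
  proof
    assume "ereal (v x) \<le> liminf (\<lambda>k. ereal (vs k (xs k)))"
    then have *: "\<forall>y<ereal (v x). eventually (\<lambda>k. y < ereal (vs k (xs k))) sequentially"
      by (simp add: le_Liminf_iff)
    show "\<forall>c<v x. eventually (\<lambda>k. c < vs k (xs k)) sequentially"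
    proof (intro allI impI)
      fix c assume "c < v x"
      with *[rule_format, of "ereal c"] show "eventually (\<lambda>k. c < vs k (xs k)) sequentially"
        by simp
    qed
  next
    assume *: "\<forall>c<v x. eventually (\<lambda>k. c < vs k (xs k)) sequentially"
    show "ereal (v x) \<le> liminf (\<lambda>k. ereal (vs k (xs k)))"
      unfolding le_Liminf_iff
    proof (intro allI impI)
      fix y :: ereal assume "y < ereal (v x)"
      then obtain z where z: "y < ereal z" "ereal z < ereal (v x)"
        using ereal_dense2 by blast
      then have "eventually (\<lambda>k. z < vs k (xs k)) sequentially"
        using * by simp
      then show "eventually (\<lambda>k. y < ereal (vs k (xs k))) sequentially"
        by eventually_elim (use z in \<open>auto intro: less_trans\<close>)
    qed
  qed
  then show ?thesis
    unfolding epi_converges_def by simp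
qed

text \<open>Constant sequences serve as recovery sequences, and convexity upgrades pointwise bounds
  to bounds along moving points. Through \<open>epi_continuousD\<close>, continuity can then be
  applied to pointwise limits of convex functions.\<close>

lemma epi_converges_pointwise:
  fixes v :: "'a::euclidean_space \<Rightarrow> real"
  assumes vs: "\<And>k::nat. vs k \<in> Conv" and lim: "\<And>x. (\<lambda>k. vs k x) \<longlonglongrightarrow> v x"
  shows "epi_converges vs v"
  unfolding epi_converges_alt
proof (intro allI conjI impI)
  fix x
  show "\<exists>xs. xs \<longlonglongrightarrow> x \<and> (\<lambda>k. vs k (xs k)) \<longlonglongrightarrow> v x"
    using lim by (intro exI[of _ "\<lambda>k. x"]) auto
  fix xs c
  assume xs: "xs \<longlonglongrightarrow> x" and c: "c < v x"
  \<comment> \<open>The midpoint inequality below gives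
    \<open>vs k (xs k) > 2 * (v x - e) - (v x + e) = v x - 3 * e = c\<close>.\<close>
  define e where "e = (v x - c) / 3"
  have e: "e > 0"
    using c by (simp add: e_def)
  have "(\<lambda>k. 2 *\<^sub>R x - xs k) \<longlonglongrightarrow> 2 *\<^sub>R x - x"
    by (intro tendsto_intros xs)
  then have refl: "(\<lambda>k. 2 *\<^sub>R x - xs k) \<longlonglongrightarrow> x"
    by (simp add: scaleR_2)
  have "eventually (\<lambda>k. vs k (2 *\<^sub>R x - xs k) < v x + e) sequentially"
    using Conv_pointwise_eventually_less[of vs v, OF vs lim refl] e by simp
  moreover have "eventually (\<lambda>k. v x - e < vs k x) sequentially"
    using order_tendstoD(1)[OF lim] e by simp
  ultimately show "eventually (\<lambda>k. c < vs k (xs k)) sequentially"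
  proof eventually_elim
    case (elim k)
    \<comment> \<open>\<open>x\<close> is the midpoint of \<open>xs k\<close> and its reflection, so the upper bound at the reflection
      yields a lower bound at \<open>xs k\<close>\<close>
    have "vs k x \<le> (1 - 1/2) * vs k (xs k) + (1/2) * vs k (2 *\<^sub>R x - xs k)"
      using ConvD[OF vs[of k], of "1/2" "xs k" "2 *\<^sub>R x - xs k"] by (simp add: algebra_simps)
    with elim show ?case
      by (simp add: e_def field_simps)
  qed
qed

text \<open>A convex \<open>w\<close> is continuous, so \<open>w (xs k)\<close> tends to
  \<open>w x\<close> whenever \<open>xs\<close> tends to \<open>x\<close>. This passes continuity of
  \<open>Z\<close> on to \<open>diff_by w Z\<close>.\<close>

lemma epi_converges_add:
  assumes "epi_converges vs v" "w \<in> Conv"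
  shows "epi_converges (\<lambda>k x. vs k x + w x) (\<lambda>x. v x + w x)"
  unfolding epi_converges_alt
proof (intro allI conjI impI)
  fix x
  have w: "(\<lambda>k. w (xs k)) \<longlonglongrightarrow> w x" if "xs \<longlonglongrightarrow> x" for xs :: "nat \<Rightarrow> 'a"
    using isCont_tendsto_compose[OF Conv_isCont[OF assms(2)] that] .
  show "\<exists>xs. xs \<longlonglongrightarrow> x \<and> (\<lambda>k. vs k (xs k) + w (xs k)) \<longlonglongrightarrow> v x + w x"
    using assms(1)[unfolded epi_converges_alt] w tendsto_add by blast
  fix xs c
  assume xs: "xs \<longlonglongrightarrow> x" and c: "c < v x + w x"
  define e where "e = (v x + w x - c) / 2"
  have e: "e > 0"
    using c by (simp add: e_def)
  have "eventually (\<lambda>k. v x - e < vs k (xs k)) sequentially"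
    using assms(1) xs e unfolding epi_converges_alt by simp
  moreover have "eventually (\<lambda>k. w x - e < w (xs k)) sequentially"
    using order_tendstoD(1)[OF w[OF xs]] e by simp
  ultimately show "eventually (\<lambda>k. c < vs k (xs k) + w (xs k)) sequentially"
    by eventually_elim (simp add: e_def field_simps)
qed

lemma epi_converges_cmul:
  assumes "epi_converges vs v" "0 \<le> c"
  shows "epi_converges (\<lambda>k x. c * vs k x) (\<lambda>x. c * v x)"
  unfolding epi_converges_alt
proof (intro allI conjI impI)
  fix x
  show "\<exists>xs. xs \<longlonglongrightarrow> x \<and> (\<lambda>k. c * vs k (xs k)) \<longlonglongrightarrow> c * v x"
    using assms(1)[unfolded epi_converges_alt] tendsto_mult_left by blast
  fix xs b
  assume xs: "xs \<longlonglongrightarrow> x" and b: "b < c * v x"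
  show "eventually (\<lambda>k. b < c * vs k (xs k)) sequentially"
  proof (cases "c = 0")
    case True
    with b show ?thesis by simp
  next
    case False
    with assms(2) have "c > 0" by simp
    with b have "b / c < v x" by (simp add: field_simps)
    with assms(1) xs have "eventually (\<lambda>k. b / c < vs k (xs k)) sequentially"
      unfolding epi_converges_alt by simp
    then show ?thesis
      by eventually_elim (use \<open>c > 0\<close> in \<open>simp add: field_simps\<close>)
  qed
qed

lemma epi_continuousD:
  assumes "epi_continuous Z" "v \<in> Conv" "\<And>k. vs k \<in> Conv" "\<And>x. (\<lambda>k. vs k x) \<longlonglongrightarrow> v x"
  shows "(\<lambda>k. Z (vs k)) \<longlonglongrightarrow> Z v"
  using assms epi_converges_pointwise[of vs v] unfolding epi_continuous_def by blast

section \<open>Differences of invariant valuations\<close>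

definition invariant_valuation :: "(('a::euclidean_space \<Rightarrow> real) \<Rightarrow> real) \<Rightarrow> bool" where
  "invariant_valuation Z \<longleftrightarrow>
     epi_continuous Z \<and> dually_epi_translation_invariant Z \<and> valuation_on Conv Z"

lemma invariant_valuation_epi_continuous: "invariant_valuation Z \<Longrightarrow> epi_continuous Z"
  by (simp add: invariant_valuation_def)

lemma invariant_valuation_affine:
  assumes "invariant_valuation Z" "u \<in> Conv"
  shows "Z (\<lambda>x. u x + a \<bullet> x + c) = Z u"
proof -
  have "Z (\<lambda>x. (u x + a \<bullet> x) + c) = Z (\<lambda>x. u x + a \<bullet> x)"
    using assms(1) Conv_add[OF assms(2) Conv_inner, of a]
    by (simp add: invariant_valuation_def dually_epi_translation_invariant_def
      vertically_translation_invariant_def)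
  also have "\<dots> = Z u"
    using assms bounded_linear.linear[OF bounded_linear_inner_right[of a]]
    unfolding invariant_valuation_def dually_epi_translation_invariant_def
      dually_translation_invariant_def by blast
  finally show ?thesis .
qed

lemma invariant_valuation_const:
  assumes "invariant_valuation Z" "u \<in> Conv"
  shows "Z (\<lambda>x. u x + c) = Z u"
  using invariant_valuation_affine[OF assms, of 0 c] by simp

definition diff_by :: "('a \<Rightarrow> real) \<Rightarrow> (('a \<Rightarrow> real) \<Rightarrow> real) \<Rightarrow> ('a \<Rightarrow> real) \<Rightarrow> real" where
  "diff_by w Z u = Z (\<lambda>x. u x + w x) - Z u"

lemma diff_by_commute: "diff_by w (diff_by w' Z) = diff_by w' (diff_by w Z)"
  by (simp add: diff_by_def fun_eq_iff add_ac)

text \<open>Adding \<open>w\<close> commutes with maxima and minima, with adding affine functions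
  and with epi-limits. Staying in the same class allows differences to be iterated.\<close>

lemma invariant_valuation_diff_by:
  fixes Z :: "('a::euclidean_space \<Rightarrow> real) \<Rightarrow> real"
  assumes Z: "invariant_valuation Z" and w: "w \<in> Conv"
  shows "invariant_valuation (diff_by w Z)"
  unfolding invariant_valuation_def
proof (intro conjI)
  have Zs: "epi_continuous Z" "dually_epi_translation_invariant Z" "valuation_on Conv Z"
    using Z by (auto simp: invariant_valuation_def)
  show "epi_continuous (diff_by w Z)"
    unfolding epi_continuous_def
  proof (intro allI ballI impI)
    fix vs and v :: "'a \<Rightarrow> real"
    assume v: "v \<in> Conv" and vs: "\<forall>k. vs k \<in> Conv" and epi: "epi_converges vs v"
    show "(\<lambda>k. diff_by w Z (vs k)) \<longlonglongrightarrow> diff_by w Z v"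
      unfolding diff_by_def
    proof (rule tendsto_diff)
      show "(\<lambda>k. Z (vs k)) \<longlonglongrightarrow> Z v"
        using Zs(1) v vs epi unfolding epi_continuous_def by blast
      show "(\<lambda>k. Z (\<lambda>x. vs k x + w x)) \<longlonglongrightarrow> Z (\<lambda>x. v x + w x)"
        using Zs(1)[unfolded epi_continuous_def, rule_format,
            of "\<lambda>x. v x + w x" "\<lambda>k x. vs k x + w x"]
          Conv_add[OF v w] Conv_add[OF _ w] vs epi_converges_add[OF epi w] by blast
    qed
  qed
  show "dually_epi_translation_invariant (diff_by w Z)"
    unfolding dually_epi_translation_invariant_def dually_translation_invariant_def
      vertically_translation_invariant_def
  proof (intro conjI ballI allI impI)
    fix v :: "'a \<Rightarrow> real" and l :: "'a \<Rightarrow> real"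
    assume v: "v \<in> Conv" and l: "linear l"
    have "Z (\<lambda>x. v x + l x) = Z v" "Z (\<lambda>x. (v x + w x) + l x) = Z (\<lambda>x. v x + w x)"
      using Zs(2) v Conv_add[OF v w] l
      by (simp_all add: dually_epi_translation_invariant_def dually_translation_invariant_def)
    then show "diff_by w Z (\<lambda>x. v x + l x) = diff_by w Z v"
      by (simp add: diff_by_def add_ac)
  next
    fix v :: "'a \<Rightarrow> real" and c :: real
    assume v: "v \<in> Conv"
    have "Z (\<lambda>x. v x + c) = Z v" "Z (\<lambda>x. (v x + w x) + c) = Z (\<lambda>x. v x + w x)"
      using Zs(2) v Conv_add[OF v w]
      by (simp_all add: dually_epi_translation_invariant_def vertically_translation_invariant_def)
    then show "diff_by w Z (\<lambda>x. v x + c) = diff_by w Z v"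
      by (simp add: diff_by_def add_ac)
  qed
  show "valuation_on Conv (diff_by w Z)"
    unfolding valuation_on_def
  proof (intro ballI impI)
    fix u v :: "'a \<Rightarrow> real"
    assume uv: "u \<in> Conv" "v \<in> Conv" "(\<lambda>x. max (u x) (v x)) \<in> Conv" "(\<lambda>x. min (u x) (v x)) \<in> Conv"
    have eqs: "(\<lambda>x. max (u x + w x) (v x + w x)) = (\<lambda>x. max (u x) (v x) + w x)"
      "(\<lambda>x. min (u x + w x) (v x + w x)) = (\<lambda>x. min (u x) (v x) + w x)"
      by (auto simp: max_def min_def)
    have "Z (\<lambda>x. max (u x) (v x)) + Z (\<lambda>x. min (u x) (v x)) = Z u + Z v"
      using Zs(3) uv unfolding valuation_on_def by blast
    moreover have "Z (\<lambda>x. max (u x) (v x) + w x) + Z (\<lambda>x. min (u x) (v x) + w x)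
        = Z (\<lambda>x. u x + w x) + Z (\<lambda>x. v x + w x)"
      using Zs(3)[unfolded valuation_on_def, rule_format,
          of "\<lambda>x. u x + w x" "\<lambda>x. v x + w x", unfolded eqs] Conv_add[OF _ w] uv by blast
    ultimately show "diff_by w Z (\<lambda>x. max (u x) (v x)) + diff_by w Z (\<lambda>x. min (u x) (v x))
        = diff_by w Z u + diff_by w Z v"
      by (simp add: diff_by_def)
  qed
qed

section \<open>Truncation of convex functions\<close>

text \<open>Chosen instead of the Euclidean norm because it is a finite sum of ridge functions,
  which hinge-invariant functionals ignore.\<close>

definition l1 :: "'a::euclidean_space \<Rightarrow> real" where
  "l1 x = (\<Sum>b\<in>Basis. \<bar>x \<bullet> b\<bar>)"

lemma norm_le_l1': "norm x \<le> l1 x"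
  unfolding l1_def by (rule norm_le_l1)

lemma l1_le_norm: "l1 (x :: 'a::euclidean_space) \<le> DIM('a) * norm x"
  unfolding l1_def by (rule sum_bounded_above) (rule Basis_le_norm)

lemma Conv_l1: "l1 \<in> Conv"
  unfolding l1_def[abs_def]
proof (rule Conv_sum)
  fix b :: 'a
  have "(\<lambda>x. max (b \<bullet> x) ((- b) \<bullet> x)) \<in> Conv"
    by (intro Conv_max Conv_inner)
  also have "(\<lambda>x. max (b \<bullet> x) ((- b) \<bullet> x)) = (\<lambda>x. \<bar>x \<bullet> b\<bar>)"
    by (auto simp: fun_eq_iff inner_commute)
  finally show "(\<lambda>x. \<bar>x \<bullet> b\<bar>) \<in> Conv" .
qed simp

lemma compact_l1_le: "compact {x :: 'a::euclidean_space. l1 x \<le> r}"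
proof (rule compact_eq_bounded_closed[THEN iffD2], intro conjI)
  show "bounded {x :: 'a. l1 x \<le> r}"
    using norm_le_l1' order_trans by (intro boundedI[of _ r]) blast
  show "closed {x :: 'a. l1 x \<le> r}"
    by (intro closed_Collect_le Conv_continuous_on Conv_l1 continuous_on_const)
qed

lemma Conv_bounded_l1_ball:
  fixes v :: "'a::euclidean_space \<Rightarrow> real"
  assumes "v \<in> Conv"
  obtains M where "0 < M" "\<And>x. l1 x \<le> r \<Longrightarrow> \<bar>v x\<bar> \<le> M"
proof -
  have "bounded (v ` {x. l1 x \<le> r})"
    by (intro compact_imp_bounded compact_continuous_image Conv_continuous_on assms compact_l1_le)
  then obtain M where "0 < M" "\<forall>y\<in>v ` {x. l1 x \<le> r}. norm y \<le> M"
    unfolding bounded_pos by blast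
  then show thesis
    by (intro that[of M]) auto
qed

text \<open>Consider a point of a segment where the new function equals \<open>v\<close>. On either
  side of it there is a point at which \<open>v\<close> lies below the chord of the new function: an
  endpoint in the sublevel set of \<open>g\<close>, or a crossing of the level \<open>r\<close>.
  Convexity of \<open>v\<close> between these two points finishes the argument.\<close>

lemma Conv_truncate:
  fixes v g :: "'a::euclidean_space \<Rightarrow> real"
  assumes v: "v \<in> Conv" and g: "g \<in> Conv" and le: "\<And>x. g x = r \<Longrightarrow> v x \<le> r"
  shows "(\<lambda>x. if g x \<le> r then max (v x) (g x) else g x) \<in> Conv"
proof (rule ConvI)
  define h where "h = (\<lambda>x. if g x \<le> r then max (v x) (g x) else g x)"
  fix x y :: 'a and t :: real
  assume t: "0 \<le> t" "t \<le> 1"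
  define p where "p = (\<lambda>\<tau>. (1 - \<tau>) *\<^sub>R x + \<tau> *\<^sub>R y)"
  \<comment> \<open>The chord over the segment \<open>p\<close>, taken between the values of
    \<open>h\<close> at its ends.\<close>
  define a where "a = (\<lambda>\<tau>. (1 - \<tau>) * h x + \<tau> * h y)"
  have gh: "g z \<le> h z" for z
    by (simp add: h_def)
  have g_le: "g (p \<tau>) \<le> a \<tau>" if "0 \<le> \<tau>" "\<tau> \<le> 1" for \<tau>
  proof -
    have "g (p \<tau>) \<le> (1 - \<tau>) * g x + \<tau> * g y"
      unfolding p_def by (rule ConvD[OF g that])
    also have "\<dots> \<le> a \<tau>"
      unfolding a_def using gh that by (intro add_mono mult_left_mono) auto
    finally show ?thesis .
  qed
  have cont: "continuous_on S (\<lambda>\<tau>. g (p \<tau>))" for S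
    unfolding p_def
    by (intro continuous_on_compose2[OF Conv_continuous_on[OF g, of UNIV]] continuous_intros) auto
  have "h (p t) \<le> a t"
  proof (cases "h (p t) = g (p t)")
    case True
    with g_le t show ?thesis by simp
  next
    case False
    then have gr: "g (p t) \<le> r" and hv: "h (p t) = v (p t)"
      by (auto simp: h_def max_def split: if_splits)
    have left: "\<exists>\<tau>. 0 \<le> \<tau> \<and> \<tau> \<le> t \<and> v (p \<tau>) \<le> a \<tau>"
    proof (cases "g x \<le> r")
      case True
      then have "v (p 0) \<le> a 0"
        by (simp add: p_def a_def h_def)
      with t show ?thesis by blast
    next
      case False
      \<comment> \<open>At a crossing \<open>v \<le> r = g \<le> a\<close>: first by the hypothesis
        \<open>le\<close>, then by \<open>g_le\<close>.\<close>
      then have "\<exists>\<tau>. 0 \<le> \<tau> \<and> \<tau> \<le> t \<and> g (p \<tau>) = r"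
        using gr t cont by (intro IVT2') (auto simp: p_def)
      then obtain \<tau> where "0 \<le> \<tau>" "\<tau> \<le> t" "g (p \<tau>) = r" by blast
      moreover from this have "v (p \<tau>) \<le> a \<tau>"
        using le[of "p \<tau>"] g_le[of \<tau>] t by linarith
      ultimately show ?thesis by blast
    qed
    have right: "\<exists>\<tau>. t \<le> \<tau> \<and> \<tau> \<le> 1 \<and> v (p \<tau>) \<le> a \<tau>"
    proof (cases "g y \<le> r")
      case True
      then have "v (p 1) \<le> a 1"
        by (simp add: p_def a_def h_def)
      with t show ?thesis by blast
    next
      case False
      then have "\<exists>\<tau>. t \<le> \<tau> \<and> \<tau> \<le> 1 \<and> g (p \<tau>) = r"
        using gr t cont by (intro IVT') (auto simp: p_def)
      then obtain \<tau> where "t \<le> \<tau>" "\<tau> \<le> 1" "g (p \<tau>) = r" by blast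
      moreover from this have "v (p \<tau>) \<le> a \<tau>"
        using le[of "p \<tau>"] g_le[of \<tau>] t by linarith
      ultimately show ?thesis by blast
    qed
    from left obtain \<tau>1 where 1: "0 \<le> \<tau>1" "\<tau>1 \<le> t" "v (p \<tau>1) \<le> a \<tau>1" by blast
    from right obtain \<tau>2 where 2: "t \<le> \<tau>2" "\<tau>2 \<le> 1" "v (p \<tau>2) \<le> a \<tau>2" by blast
    show ?thesis
    proof (cases "\<tau>1 = \<tau>2")
      case True
      with 1 2 have "\<tau>1 = t" by simp
      with 1 hv show ?thesis by simp
    next
      case False
      with 1 2 have lt: "\<tau>1 < \<tau>2" by simp
      define s where "s = (t - \<tau>1) / (\<tau>2 - \<tau>1)"
      have s: "0 \<le> s" "s \<le> 1"
        using lt 1 2 by (auto simp: s_def field_simps)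
      have ts: "t = (1 - s) * \<tau>1 + s * \<tau>2"
      proof -
        have "s * (\<tau>2 - \<tau>1) = t - \<tau>1"
          using lt by (simp add: s_def)
        then show ?thesis by (simp add: algebra_simps)
      qed
      have "p t = (1 - s) *\<^sub>R p \<tau>1 + s *\<^sub>R p \<tau>2"
        unfolding p_def ts by (simp add: algebra_simps)
      then have "v (p t) \<le> (1 - s) * v (p \<tau>1) + s * v (p \<tau>2)"
        using ConvD[OF v s] by simp
      also have "\<dots> \<le> (1 - s) * a \<tau>1 + s * a \<tau>2"
        using s 1 2 by (intro add_mono mult_left_mono) auto
      also have "\<dots> = a t"
        unfolding a_def ts by (simp add: algebra_simps)
      finally show ?thesis using hv by simp
    qed
  qed
  then show "(if g ((1 - t) *\<^sub>R x + t *\<^sub>R y) \<le> r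
      then max (v ((1 - t) *\<^sub>R x + t *\<^sub>R y)) (g ((1 - t) *\<^sub>R x + t *\<^sub>R y))
      else g ((1 - t) *\<^sub>R x + t *\<^sub>R y))
     \<le> (1 - t) * (if g x \<le> r then max (v x) (g x) else g x)
      + t * (if g y \<le> r then max (v y) (g y) else g y)"
    by (simp add: p_def a_def h_def)
qed

text \<open>The point of this form is that \<open>v - (C * l1 - D)\<close> is nonnegative with
  bounded support, so it can act as a density in \<open>null_tame\<close>.\<close>

definition tame :: "('a::euclidean_space \<Rightarrow> real) \<Rightarrow> bool" where
  "tame v \<longleftrightarrow> v \<in> Conv \<and>
     (\<exists>C\<ge>0. \<exists>D r. \<forall>x. C * l1 x - D \<le> v x \<and> (r \<le> l1 x \<longrightarrow> v x = C * l1 x - D))"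

lemma tame_agreeing_on_ball:
  fixes v :: "'a::euclidean_space \<Rightarrow> real"
  assumes v: "v \<in> Conv" and R: "0 < R"
  obtains w where "tame w" "\<And>x. l1 x \<le> R \<Longrightarrow> w x = v x"
proof -
  obtain M where M: "0 < M" "\<And>x. l1 x \<le> 2 * R \<Longrightarrow> \<bar>v x\<bar> \<le> M"
    using Conv_bounded_l1_ball[OF v, of "2 * R"] by blast
  \<comment> \<open>The cone \<open>g\<close> rises from \<open>- M\<close> at
    \<open>l1 x = R\<close> to \<open>M\<close> at \<open>l1 x = 2 * R\<close>: it is below
    \<open>v\<close> on the inner ball and above \<open>v\<close> on the outer sphere.\<close>
  define C where "C = 2 * M / R"
  define g where "g = (\<lambda>x :: 'a. C * l1 x - 3 * M)"
  have C: "C > 0"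
    using M R by (simp add: C_def)
  have CR: "C * R = 2 * M"
    using R by (simp add: C_def)
  have g: "g \<in> Conv"
    using Conv_add[OF Conv_cmul[OF _ Conv_l1, of C] Conv_const, of "- 3 * M"] C by (simp add: g_def)
  have g_le: "g x \<le> M \<longleftrightarrow> l1 x \<le> 2 * R" for x
  proof -
    have "g x \<le> M \<longleftrightarrow> C * l1 x \<le> C * (2 * R)"
      using CR by (auto simp: g_def)
    also have "\<dots> \<longleftrightarrow> l1 x \<le> 2 * R"
      using C by simp
    finally show ?thesis .
  qed
  define w where "w = (\<lambda>x. if g x \<le> M then max (v x) (g x) else g x)"
  have "w \<in> Conv"
    unfolding w_def
  proof (rule Conv_truncate[OF v g])
    fix x assume "g x = M"
    then have "l1 x \<le> 2 * R"
      using g_le[of x] by simp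
    then show "v x \<le> M"
      using M(2)[of x] by simp
  qed
  moreover have "w x = g x" if "2 * R \<le> l1 x" for x
  proof (cases "l1 x = 2 * R")
    case True
    then have "g x = M"
      using CR by (simp add: g_def)
    moreover have "v x \<le> M"
      using M(2)[of x] True by simp
    ultimately show ?thesis by (simp add: w_def)
  next
    case False
    with that g_le[of x] show ?thesis by (simp add: w_def)
  qed
  moreover have "g x \<le> w x" for x
    by (simp add: w_def)
  ultimately have "tame w"
    unfolding tame_def g_def using C less_imp_le by blast
  moreover have "w x = v x" if "l1 x \<le> R" for x
  proof -
    have "C * l1 x \<le> C * R"
      using that C by simp
    then have "g x \<le> - M"
      using CR by (simp add: g_def)
    moreover have "- M \<le> v x"
      using M(2)[of x] that R by simp
    ultimately show ?thesis
      using M(1) by (simp add: w_def)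
  qed
  ultimately show thesis
    using that by blast
qed

lemma tame_approximation:
  fixes v :: "'a::euclidean_space \<Rightarrow> real"
  assumes "v \<in> Conv"
  obtains vs where "\<And>k::nat. tame (vs k)" "\<And>x. (\<lambda>k. vs k x) \<longlonglongrightarrow> v x"
proof -
  have "\<exists>w. tame w \<and> (\<forall>x. l1 x \<le> real (Suc k) \<longrightarrow> w x = v x)" for k
    using tame_agreeing_on_ball[OF assms, of "real (Suc k)"] by (metis of_nat_0_less_iff zero_less_Suc)
  then obtain vs where vs: "\<And>k. tame (vs k)" "\<And>k x. l1 x \<le> real (Suc k) \<Longrightarrow> vs k x = v x"
    by metis
  have "(\<lambda>k. vs k x) \<longlonglongrightarrow> v x" for x
  proof (rule tendsto_eventually)
    obtain K :: nat where "l1 x \<le> real K"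
      using real_arch_simple by blast
    then have "\<forall>k\<ge>K. vs k x = v x"
      using vs(2) by simp
    then show "eventually (\<lambda>k. vs k x = v x) sequentially"
      by (auto simp: eventually_sequentially)
  qed
  with vs(1) show thesis
    using that by blast
qed

section \<open>Lipschitz bounds\<close>

text \<open>Write \<open>y + d\<close> as a convex combination of \<open>y\<close> and the far point
  \<open>y + (1 / t) *\<^sub>R d\<close>, with weight \<open>t\<close> on the latter. Inserting the
  growth bound at the far point and letting \<open>t\<close> tend to 0 leaves only the slope
  \<open>L\<close>.\<close>

lemma Conv_linear_growth_Lipschitz:
  assumes v: "v \<in> Conv" and L: "0 \<le> L" and le: "\<And>x. v x \<le> A + L * norm x"
  shows "\<bar>v x - v y\<bar> \<le> L * norm (x - y)"
proof -
  have *: "v (y + d) - v y - L * norm d \<le> 0" for y d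
  proof -
    define K where "K = A + L * norm y - v y"
    have "v (y + d) - v y - L * norm d \<le> K / real (Suc k)" for k
    proof -
      define t where "t = 1 / real (Suc k)"
      have t: "0 < t" "t \<le> 1" by (auto simp: t_def)
      have "y + d = (1 - t) *\<^sub>R y + t *\<^sub>R (y + (1 / t) *\<^sub>R d)"
        using t by (simp add: algebra_simps)
      then have "v (y + d) \<le> (1 - t) * v y + t * v (y + (1 / t) *\<^sub>R d)"
        using ConvD[OF v, of t] t by simp
      moreover have "v (y + (1 / t) *\<^sub>R d) \<le> A + L * (norm y + norm d / t)"
      proof -
        have "norm (y + (1 / t) *\<^sub>R d) \<le> norm y + norm d / t"
          using norm_triangle_ineq[of y "(1 / t) *\<^sub>R d"] t by simp
        then show ?thesis
          using le[of "y + (1 / t) *\<^sub>R d"] L by (meson add_left_mono mult_left_mono order_trans)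
      qed
      then have "t * v (y + (1 / t) *\<^sub>R d) \<le> t * (A + L * (norm y + norm d / t))"
        using t by (intro mult_left_mono) auto
      moreover have "(1 - t) * v y + t * (A + L * (norm y + norm d / t)) = v y + L * norm d + t * K"
        using t by (simp add: K_def algebra_simps)
      ultimately have "v (y + d) \<le> v y + L * norm d + t * K"
        by linarith
      then show ?thesis
        by (simp add: t_def)
    qed
    moreover have "(\<lambda>k. K / real (Suc k)) \<longlonglongrightarrow> 0"
      by (rule LIMSEQ_Suc) (rule lim_const_over_n)
    ultimately show ?thesis
      by (intro LIMSEQ_le_const) auto
  qed
  show ?thesis
    using *[of y "x - y"] *[of x "y - x"] by (simp add: norm_minus_commute abs_le_iff)
qed

text \<open>The slope is read off at infinity: outside a bounded set \<open>v\<close> is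
  \<open>C * l1 - D\<close>, and \<open>l1\<close> is at most \<open>DIM('a)\<close> times the
  norm.\<close>

lemma tame_Lipschitz:
  fixes v :: "'a::euclidean_space \<Rightarrow> real"
  assumes "tame v"
  obtains L where "0 \<le> L" "\<And>x y. \<bar>v x - v y\<bar> \<le> L * norm (x - y)"
proof -
  from assms obtain C D r where v: "v \<in> Conv" and C: "0 \<le> C"
    and eq: "\<And>x. r \<le> l1 x \<Longrightarrow> v x = C * l1 x - D"
    unfolding tame_def by blast
  obtain M where M: "0 < M" "\<And>x. l1 x \<le> r \<Longrightarrow> \<bar>v x\<bar> \<le> M"
    using Conv_bounded_l1_ball[OF v] by blast
  have "v x \<le> (M + \<bar>D\<bar>) + (C * DIM('a)) * norm x" for x
  proof (cases "r \<le> l1 x")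
    case True
    then show ?thesis
      using eq[of x] mult_left_mono[OF l1_le_norm[of x] C] M(1) by (simp add: mult.assoc)
  next
    case False
    then have "v x \<le> M"
      using M(2)[of x] by simp
    moreover have "0 \<le> (C * DIM('a)) * norm x"
      using C by simp
    ultimately show ?thesis by linarith
  qed
  from Conv_linear_growth_Lipschitz[OF v _ this] C show thesis
    by (intro that[of "C * DIM('a)"]) auto
qed

section \<open>Differences along hinges\<close>

definition hinge :: "'a::euclidean_space \<Rightarrow> real \<Rightarrow> 'a \<Rightarrow> real" where
  "hinge a \<alpha> x = max 0 (a \<bullet> x - \<alpha>)"

lemma Conv_hinge: "hinge a \<alpha> \<in> Conv"
  unfolding hinge_def[abs_def]
  using Conv_max[OF Conv_const[of 0] Conv_inner_add[OF Conv_const[of 0], of a "- \<alpha>"]] by simp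

text \<open>This is \<open>max 0 s = max 0 (- s) + s\<close>. Opposite hinges differ by an affine
  function, so an invariant valuation cannot tell on which side of the kink the hinge rises.\<close>

lemma hinge_uminus: "hinge a \<alpha> x = hinge (- a) (- \<alpha>) x + a \<bullet> x + - \<alpha>"
  by (simp add: hinge_def max_def)

lemma invariant_valuation_max_min:
  assumes Y: "invariant_valuation Y" and "u \<in> Conv" "v \<in> Conv" "p \<in> Conv" "q \<in> Conv"
    and "\<And>x. p x = max (u x) (v x)" "\<And>x. q x = min (u x) (v x)"
  shows "Y p + Y q = Y u + Y v"
proof -
  have eqs: "p = (\<lambda>x. max (u x) (v x))" "q = (\<lambda>x. min (u x) (v x))"
    using assms by auto
  have "valuation_on Conv Y"
    using Y by (simp add: invariant_valuation_def)
  from this[unfolded valuation_on_def, rule_format, OF assms(2,3)] assms(4,5)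
  show ?thesis unfolding eqs by simp
qed

text \<open>If \<open>w \<le> p\<close> with equality where the hinge is active, then
  \<open>w + hinge\<close> and \<open>p\<close> have maximum \<open>p + hinge\<close> and minimum
  \<open>w\<close>, and the valuation property equates the two differences. Both \<open>u\<close>
  and \<open>v\<close> are compared in this way with their maximum.\<close>

lemma diff_by_hinge_eq_if_eq_halfspace:
  assumes Y: "invariant_valuation Y" and u: "u \<in> Conv" and v: "v \<in> Conv"
    and eq: "\<And>x. \<alpha> \<le> a \<bullet> x \<Longrightarrow> u x = v x"
  shows "diff_by (hinge a \<alpha>) Y u = diff_by (hinge a \<alpha>) Y v"
proof -
  define p where "p = (\<lambda>x. max (u x) (v x))"
  have p: "p \<in> Conv"
    unfolding p_def by (rule Conv_max[OF u v])
  have "diff_by (hinge a \<alpha>) Y w = diff_by (hinge a \<alpha>) Y p"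
    if w: "w \<in> Conv" and le: "\<And>x. w x \<le> p x" and weq: "\<And>x. \<alpha> \<le> a \<bullet> x \<Longrightarrow> w x = p x" for w
  proof -
    have "Y (\<lambda>x. p x + hinge a \<alpha> x) + Y w = Y (\<lambda>x. w x + hinge a \<alpha> x) + Y p"
    proof (rule invariant_valuation_max_min[OF Y Conv_add[OF w Conv_hinge] p Conv_add[OF p Conv_hinge] w])
      fix x
      show "p x + hinge a \<alpha> x = max (w x + hinge a \<alpha> x) (p x)"
        "w x = min (w x + hinge a \<alpha> x) (p x)"
        using le[of x] weq[of x] by (auto simp: hinge_def max_def min_def)
    qed
    then show ?thesis by (simp add: diff_by_def)
  qed
  from this[OF u] this[OF v] show ?thesis
    using eq by (auto simp: p_def)
qed

lemma diff_by_hinge_uminus: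
  assumes Y: "invariant_valuation Y" and u: "u \<in> Conv"
  shows "diff_by (hinge a \<alpha>) Y u = diff_by (hinge (- a) (- \<alpha>)) Y u"
proof -
  have "(\<lambda>x. u x + hinge a \<alpha> x) = (\<lambda>x. (u x + hinge (- a) (- \<alpha>) x) + a \<bullet> x + - \<alpha>)"
    by (subst hinge_uminus) (simp add: add_ac)
  then show ?thesis
    unfolding diff_by_def
    using invariant_valuation_affine[OF Y Conv_add[OF u Conv_hinge], of "- a" "- \<alpha>" a "- \<alpha>"] by simp
qed

lemma diff_by_hinge_eq_if_eq_halfspace':
  assumes Y: "invariant_valuation Y" and u: "u \<in> Conv" and v: "v \<in> Conv"
    and eq: "\<And>x. a \<bullet> x \<le> \<alpha> \<Longrightarrow> u x = v x"
  shows "diff_by (hinge a \<alpha>) Y u = diff_by (hinge a \<alpha>) Y v"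
  using diff_by_hinge_eq_if_eq_halfspace[OF Y u v, of "- \<alpha>" "- a"] eq
  by (simp add: diff_by_hinge_uminus[OF Y u, of a] diff_by_hinge_uminus[OF Y v, of a])

text \<open>Up to affine functions, the two convex functions are glued along the hyperplane as
  \<open>max (u - M s) (v + M s)\<close>, where \<open>s = a \<bullet> x - \<alpha>\<close>.\<close>

lemma diff_by_hinge_eq_if_close:
  assumes Y: "invariant_valuation Y" and u: "u \<in> Conv" and v: "v \<in> Conv"
    and M: "0 \<le> M" and close: "\<And>x. \<bar>u x - v x\<bar> \<le> M * \<bar>a \<bullet> x - \<alpha>\<bar>"
  shows "diff_by (hinge a \<alpha>) Y u = diff_by (hinge a \<alpha>) Y v"
proof -
  define p where "p = (\<lambda>x. u x + (- M *\<^sub>R a) \<bullet> x + M * \<alpha>)"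
  define q where "q = (\<lambda>x. v x + (M *\<^sub>R a) \<bullet> x + - (M * \<alpha>))"
  have p: "p \<in> Conv" and q: "q \<in> Conv"
    unfolding p_def q_def by (rule Conv_inner_add u v)+
  have w: "(\<lambda>x. max (p x) (q x)) \<in> Conv"
    by (rule Conv_max[OF p q])
  \<comment> \<open>With \<open>s = a \<bullet> x - \<alpha>\<close>, the tilt
    \<open>2 * M * s\<close> outweighs \<open>u - v\<close>, whose size is at most
    \<open>M * |s|\<close>. So the maximum is \<open>p\<close> for \<open>s \<le> 0\<close> and
    \<open>q\<close> for \<open>s \<ge> 0\<close>.\<close>
  have pq: "p x - q x = u x - v x - 2 * (M * (a \<bullet> x - \<alpha>))" for x
    by (simp add: p_def q_def algebra_simps)
  have D: "invariant_valuation (diff_by (hinge a \<alpha>) Y)"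
    by (rule invariant_valuation_diff_by[OF Y Conv_hinge])
  have "diff_by (hinge a \<alpha>) Y u = diff_by (hinge a \<alpha>) Y p"
    unfolding p_def by (rule invariant_valuation_affine[OF D u, symmetric])
  also have "\<dots> = diff_by (hinge a \<alpha>) Y (\<lambda>x. max (p x) (q x))"
  proof (rule diff_by_hinge_eq_if_eq_halfspace'[OF Y p w])
    fix x assume "a \<bullet> x \<le> \<alpha>"
    then have "\<bar>a \<bullet> x - \<alpha>\<bar> = - (a \<bullet> x - \<alpha>)"
      by simp
    then have "M * \<bar>a \<bullet> x - \<alpha>\<bar> = - (M * (a \<bullet> x - \<alpha>))"
      by (simp only: mult_minus_right)
    moreover have "M * (a \<bullet> x - \<alpha>) \<le> 0"
      using M \<open>a \<bullet> x \<le> \<alpha>\<close> by (simp add: mult_le_0_iff)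
    ultimately show "p x = max (p x) (q x)"
      using pq[of x] close[of x] by simp
  qed
  also have "\<dots> = diff_by (hinge a \<alpha>) Y q"
  proof (rule diff_by_hinge_eq_if_eq_halfspace[OF Y w q])
    fix x assume "\<alpha> \<le> a \<bullet> x"
    then have "M * \<bar>a \<bullet> x - \<alpha>\<bar> = M * (a \<bullet> x - \<alpha>)" "0 \<le> M * (a \<bullet> x - \<alpha>)"
      using M by auto
    then show "max (p x) (q x) = q x"
      using pq[of x] close[of x] by simp
  qed
  also have "\<dots> = diff_by (hinge a \<alpha>) Y v"
    unfolding q_def by (rule invariant_valuation_affine[OF D v])
  finally show ?thesis .
qed

text \<open>The argument of \<open>u\<close> is projected along \<open>d\<close> onto the kink
  hyperplane, so only the restriction of \<open>u\<close> to it matters. A function with Lipschitz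
  constant \<open>L\<close> differs from its projected version by at most
  \<open>L * norm d * |a \<bullet> x - \<alpha>|\<close>, which is the closeness required above;
  tame approximation reaches general \<open>u\<close>.\<close>

lemma diff_by_hinge_project:
  assumes Y: "invariant_valuation Y" and u: "u \<in> Conv" and d: "a \<bullet> d = 1"
  shows "diff_by (hinge a \<alpha>) Y (\<lambda>x. u (x - (a \<bullet> x - \<alpha>) *\<^sub>R d)) = diff_by (hinge a \<alpha>) Y u"
proof -
  define P where "P = (\<lambda>w :: 'a \<Rightarrow> real. \<lambda>x. w (x - (a \<bullet> x - \<alpha>) *\<^sub>R d))"
  have P: "P w \<in> Conv" if "w \<in> Conv" for w
  proof -
    have "linear (\<lambda>x. x - (a \<bullet> x) *\<^sub>R d)"
      by (rule linearI) (simp_all add: inner_add_right algebra_simps)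
    from Conv_comp_affine[OF that this, of "\<alpha> *\<^sub>R d"] show ?thesis
      by (simp add: P_def algebra_simps)
  qed
  obtain us where us: "\<And>k::nat. tame (us k)" "\<And>x. (\<lambda>k. us k x) \<longlonglongrightarrow> u x"
    using tame_approximation[OF u] by blast
  have Conv_us: "us k \<in> Conv" for k
    using us(1) by (simp add: tame_def)
  have D: "epi_continuous (diff_by (hinge a \<alpha>) Y)"
    by (intro invariant_valuation_epi_continuous invariant_valuation_diff_by Y Conv_hinge)
  have "diff_by (hinge a \<alpha>) Y (P (us k)) = diff_by (hinge a \<alpha>) Y (us k)" for k
  proof -
    obtain L where L: "0 \<le> L" "\<And>x y. \<bar>us k x - us k y\<bar> \<le> L * norm (x - y)"
      using tame_Lipschitz[OF us(1)] by blast
    show ?thesis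
    proof (rule diff_by_hinge_eq_if_close[OF Y P[OF Conv_us] Conv_us])
      show "0 \<le> L * norm d"
        using L by simp
      fix x
      show "\<bar>P (us k) x - us k x\<bar> \<le> L * norm d * \<bar>a \<bullet> x - \<alpha>\<bar>"
        using L(2)[of "x - (a \<bullet> x - \<alpha>) *\<^sub>R d" x] by (simp add: P_def mult_ac)
    qed
  qed
  moreover have "(\<lambda>k. diff_by (hinge a \<alpha>) Y (us k)) \<longlonglongrightarrow> diff_by (hinge a \<alpha>) Y u"
    using us(2) by (rule epi_continuousD[OF D u Conv_us])
  moreover have "(\<lambda>k. diff_by (hinge a \<alpha>) Y (P (us k))) \<longlonglongrightarrow> diff_by (hinge a \<alpha>) Y (P u)"
    by (rule epi_continuousD[OF D P[OF u] P[OF Conv_us]]) (simp add: P_def us(2))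
  ultimately have "diff_by (hinge a \<alpha>) Y (P u) = diff_by (hinge a \<alpha>) Y u"
    using LIMSEQ_unique by auto
  then show ?thesis by (simp add: P_def)
qed

section \<open>Iterated differences along hinges\<close>

fun iter_diff :: "('a \<Rightarrow> real) list \<Rightarrow> (('a \<Rightarrow> real) \<Rightarrow> real) \<Rightarrow> ('a \<Rightarrow> real) \<Rightarrow> real" where
  "iter_diff [] Z = Z"
| "iter_diff (w # ws) Z = iter_diff ws (diff_by w Z)"

lemma iter_diff_diff_by: "iter_diff ws (diff_by w Z) = diff_by w (iter_diff ws Z)"
  by (induction ws arbitrary: Z) (simp_all add: diff_by_commute[of _ w])

lemma invariant_valuation_iter_diff:
  "invariant_valuation Z \<Longrightarrow> set ws \<subseteq> Conv \<Longrightarrow> invariant_valuation (iter_diff ws Z)"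
  by (induction ws arbitrary: Z) (simp_all add: invariant_valuation_diff_by)

lemma iter_diff_eq_0:
  assumes "\<And>u. u \<in> Conv \<Longrightarrow> Z u = 0" "set ws \<subseteq> Conv" "u \<in> Conv"
  shows "iter_diff ws Z u = 0"
  using assms by (induction ws arbitrary: Z u) (simp_all add: diff_by_def Conv_add)

text \<open>Each difference along a hinge confines the dependence on \<open>u\<close> to the intersection with
  one more hyperplane; the affine projection \<open>x \<mapsto> A x + b\<close> onto this intersection loses
  rank until the hinge is constant on it.\<close>

lemma iter_diff_hinges_eq_0_if_projection:
  fixes Y :: "('a::euclidean_space \<Rightarrow> real) \<Rightarrow> real" and A :: "'a \<Rightarrow> 'a"
  assumes "invariant_valuation Y" and "linear A" and "\<And>x. A (A x) = A x" and "A b = 0"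
    and "\<And>u. u \<in> Conv \<Longrightarrow> Y (\<lambda>x. u (A x + b)) = Y u"
    and "dim (range A) < length ws" and "set ws \<subseteq> range (case_prod hinge)" and "u \<in> Conv"
  shows "iter_diff ws Y u = 0"
  using assms
proof (induction ws arbitrary: Y A b u)
  case Nil
  then show ?case by simp
next
  case (Cons w ws)
  note Y = Cons.prems(1) and A = Cons.prems(2) and AA = Cons.prems(3) and Ab = Cons.prems(4)
    and fac = Cons.prems(5)
  obtain a \<alpha> where w: "w = hinge a \<alpha>"
    using Cons.prems(7) by auto
  have ws: "set ws \<subseteq> Conv"
    using Cons.prems(7) Conv_hinge by fastforce
  \<comment> \<open>Pulled back along \<open>A x + b\<close>, the hinge is again a hinge, with
    normal \<open>a'\<close> and offset \<open>\<alpha>'\<close>. By \<open>fac\<close> it may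
    replace the original one.\<close>
  define a' where "a' = adjoint A a"
  define \<alpha>' where "\<alpha>' = \<alpha> - a \<bullet> b"
  have a': "a' \<bullet> x = a \<bullet> A x" for x
    unfolding a'_def by (metis A adjoint_works inner_commute)
  have hinge': "hinge a \<alpha> (A x + b) = hinge a' \<alpha>' x" for x
    by (simp add: hinge_def a' \<alpha>'_def inner_add_right)
  have fac_hinge: "Y (\<lambda>x. v x + hinge a \<alpha> x) = Y (\<lambda>x. v (A x + b) + hinge a' \<alpha>' x)"
    if "v \<in> Conv" for v
    using fac[OF Conv_add[OF that Conv_hinge[of a \<alpha>]]] by (simp add: hinge')
  show ?case
  proof (cases "a' = 0")
    case True
    \<comment> \<open>The pulled-back hinge is a constant here, so vertical invariance already
      annihilates the first difference.\<close>
    have "diff_by w Y v = 0" if v: "v \<in> Conv" for v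
    proof -
      have "Y (\<lambda>x. v (A x + b) + hinge a' \<alpha>' x) = Y (\<lambda>x. v (A x + b))"
        using invariant_valuation_const[OF Y Conv_comp_affine[OF v A]] True by (simp add: hinge_def)
      then show ?thesis
        using fac_hinge[OF v] fac[OF v] by (simp add: diff_by_def w)
    qed
    from iter_diff_eq_0[OF this ws Cons.prems(8)] show ?thesis by simp
  next
    case False
    define d where "d = a' /\<^sub>R (a' \<bullet> a')"
    have d: "a' \<bullet> d = 1"
      using False by (simp add: d_def)
    \<comment> \<open>\<open>A' x + b'\<close> is the projection along \<open>d\<close> onto the
      hyperplane \<open>a' \<bullet> x = \<alpha>'\<close>, followed by
      \<open>A x + b\<close>.\<close>
    define A' where "A' = (\<lambda>x. A x - (a' \<bullet> x) *\<^sub>R A d)"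
    define b' where "b' = b + \<alpha>' *\<^sub>R A d"
    note lin = linear_add[OF A] linear_diff[OF A] linear_cmul[OF A]
    have A': "linear A'"
      unfolding A'_def by (rule linearI) (simp_all add: lin inner_add_right algebra_simps)
    have a'A: "a' \<bullet> A x = a' \<bullet> x" for x
      by (simp add: a' AA)
    have a'b: "a' \<bullet> b = 0"
      by (simp add: a' Ab)
    have "iter_diff ws (diff_by w Y) u = 0"
    proof (rule Cons.IH[OF _ A'])
      show "invariant_valuation (diff_by w Y)"
        unfolding w by (rule invariant_valuation_diff_by[OF Y Conv_hinge])
      show "A' (A' x) = A' x" for x
        by (simp add: A'_def lin AA inner_diff_right a'A d)
      show "A' b' = 0"
        by (simp add: A'_def b'_def lin AA Ab inner_add_right a'A a'b d)
      show "diff_by w Y (\<lambda>x. v (A' x + b')) = diff_by w Y v" if v: "v \<in> Conv" for v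
      proof -
        have v': "(\<lambda>x. v (A' x + b')) \<in> Conv" and vA: "(\<lambda>x. v (A x + b)) \<in> Conv"
          by (rule Conv_comp_affine[OF v A'] Conv_comp_affine[OF v A])+
        \<comment> \<open>The new projection absorbs the old one, so \<open>fac\<close> changes only
          the hinge and leaves the projected \<open>v\<close> as it is.\<close>
        have "A' (A x + b) + b' = A' x + b'" for x
          by (simp add: A'_def lin AA Ab inner_add_right a'A a'b)
        then have "diff_by w Y (\<lambda>x. v (A' x + b')) = diff_by (hinge a' \<alpha>') Y (\<lambda>x. v (A' x + b'))"
          using fac_hinge[OF v'] by (simp add: diff_by_def w)
        also have "\<dots> = diff_by (hinge a' \<alpha>') Y (\<lambda>y. v (A y + b))"
        proof -
          have "(\<lambda>x. v (A (x - (a' \<bullet> x - \<alpha>') *\<^sub>R d) + b)) = (\<lambda>x. v (A' x + b'))"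
            by (simp add: A'_def b'_def lin algebra_simps)
          then show ?thesis
            using diff_by_hinge_project[OF Y vA d, of \<alpha>'] by simp
        qed
        also have "\<dots> = diff_by w Y v"
          using fac_hinge[OF v] fac[OF v] by (simp add: diff_by_def w)
        finally show ?thesis .
      qed
      show "dim (range A') < length ws"
      proof -
        have sub: "range A' \<subseteq> range A"
        proof
          fix y assume "y \<in> range A'"
          then obtain x where "y = A (x - (a' \<bullet> x) *\<^sub>R d)"
            by (auto simp: A'_def lin)
          then show "y \<in> range A" by blast
        qed
        \<comment> \<open>The rank drops because \<open>A d\<close> lies in the range of
          \<open>A\<close> but not in that of \<open>A'\<close>, which is orthogonal to
          \<open>a'\<close>.\<close>
        have "a' \<bullet> A d = 1"
          by (simp add: a'A d)
        moreover have "a' \<bullet> A' x = 0" for x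
          by (simp add: A'_def inner_diff_right a'A d)
        ultimately have "A d \<notin> range A'"
          by auto
        with sub have "range A' \<noteq> range A"
          by blast
        then have "dim (range A') < dim (range A)"
          using sub subspace_dim_equal[of "range A'" "range A"]
            linear_subspace_image[OF A subspace_UNIV] linear_subspace_image[OF A' subspace_UNIV]
          by (meson not_le)
        with Cons.prems(6) show ?thesis by simp
      qed
      show "set ws \<subseteq> range (case_prod hinge)" "u \<in> Conv"
        using Cons.prems(7,8) by auto
    qed
    then show ?thesis by simp
  qed
qed

text \<open>Start from the identity, a projection of rank \<open>DIM('a)\<close>; there is one hinge
  more than this rank.\<close>

lemma iter_diff_hinges_eq_0:
  fixes Z :: "('a::euclidean_space \<Rightarrow> real) \<Rightarrow> real"
  assumes "invariant_valuation Z" "length ws = Suc DIM('a)"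
    "set ws \<subseteq> range (case_prod hinge)" "u \<in> Conv"
  shows "iter_diff ws Z u = 0"
  using assms iter_diff_hinges_eq_0_if_projection[of Z "\<lambda>x. x" 0 ws u]
  by (simp add: linear_id[unfolded id_def])

section \<open>Convex ridge functions and Gaussians\<close>

text \<open>The piecewise linear interpolation of \<open>\<phi>\<close> on \<open>[- N, N]\<close> with mesh \<open>1 / N\<close>.\<close>

lemma Conv_real_max_approximation:
  fixes \<phi> :: "real \<Rightarrow> real"
  assumes \<phi>: "\<phi> \<in> Conv" and N: "0 < N"
  obtains p q c t and m :: nat where "\<And>k. 0 \<le> c k"
    "\<And>s. \<bar>s\<bar> \<le> real N \<Longrightarrow> \<exists>y z \<mu>. \<bar>y - s\<bar> \<le> 1 / N \<and> \<bar>z - s\<bar> \<le> 1 / N \<and> 0 \<le> \<mu> \<and> \<mu> \<le> 1 \<and>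
      p + q * s + (\<Sum>k<m. c k * max 0 (s - t k)) = (1 - \<mu>) * \<phi> y + \<mu> * \<phi> z"
proof -
  define t where "t = (\<lambda>k::nat. - real N + real k / real N)"
  \<comment> \<open>Slope of the chord over a cell of length \<open>1 / N\<close>. The interval
    consists of \<open>m = 2 * N * N\<close> such cells, and the jumps of the slope are the weights
    of the kinks.\<close>
  define \<sigma> where "\<sigma> = (\<lambda>k. (\<phi> (t (Suc k)) - \<phi> (t k)) * real N)"
  define m where "m = 2 * N * N"
  define S where "S = (\<lambda>n s. \<phi> (t 0) + \<sigma> 0 * (s - t 0) + (\<Sum>k<n. (\<sigma> (Suc k) - \<sigma> k) * max 0 (s - t (Suc k))))"
  have step: "t (Suc k) - t k = 1 / real N" for k
    by (simp add: t_def add_divide_distrib)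
  have mono_t: "t j \<le> t k \<longleftrightarrow> j \<le> k" for j k
    using N by (simp add: t_def divide_le_cancel)
  have slopes: "0 \<le> \<sigma> (Suc k) - \<sigma> k" for k
  proof -
    have "t (Suc k) = (1 - 1/2) *\<^sub>R t k + (1/2) *\<^sub>R t (Suc (Suc k))"
      using step[of k] step[of "Suc k"] by simp
    then have "\<phi> (t (Suc k)) \<le> (1 - 1/2) * \<phi> (t k) + (1/2) * \<phi> (t (Suc (Suc k)))"
      using ConvD[OF \<phi>, of "1/2" "t k" "t (Suc (Suc k))"] by simp
    then have "0 \<le> (\<phi> (t (Suc (Suc k))) - \<phi> (t (Suc k)) - (\<phi> (t (Suc k)) - \<phi> (t k))) * real N"
      by (intro mult_nonneg_nonneg) auto
    then show ?thesis by (simp add: \<sigma>_def algebra_simps)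
  qed
  \<comment> \<open>Without the cut-off at 0 the first \<open>j\<close> kinks telescope to the line
    through the chord over the cell starting at \<open>t j\<close>.\<close>
  have interp: "\<phi> (t 0) + \<sigma> 0 * (s - t 0) + (\<Sum>k<j. (\<sigma> (Suc k) - \<sigma> k) * (s - t (Suc k)))
      = \<phi> (t j) + \<sigma> j * (s - t j)" for s j
  proof (induction j)
    case (Suc j)
    have "\<phi> (t (Suc j)) - \<phi> (t j) = \<sigma> j * (t (Suc j) - t j)"
      using N step[of j] by (simp add: \<sigma>_def)
    then show ?case
      using Suc by (simp add: algebra_simps)
  qed simp
  show thesis
  proof (rule that[of "\<lambda>k. \<sigma> (Suc k) - \<sigma> k" "\<phi> (t 0) - \<sigma> 0 * t 0" "\<sigma> 0" "\<lambda>k. t (Suc k)" m])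
    fix s :: real assume s: "\<bar>s\<bar> \<le> real N"
    \<comment> \<open>Index of the cell containing \<open>s\<close>: the kinks from
      \<open>t (Suc j)\<close> on contribute nothing. At the right end \<open>s = N\<close> this
      index equals \<open>m\<close>, hence only \<open>j \<le> m\<close> below.\<close>
    define j where "j = nat \<lfloor>(s + real N) * real N\<rfloor>"
    have nn: "0 \<le> (s + real N) * real N"
      using s by (intro mult_nonneg_nonneg) auto
    then have j: "real j \<le> (s + real N) * real N" "(s + real N) * real N < real j + 1"
      unfolding j_def by linarith+
    have "(s + real N) * real N \<le> (real N + real N) * real N"
      using s by (intro mult_right_mono) auto
    then have "real j \<le> real m"
      using j(1) by (simp add: m_def algebra_simps)
    then have jm: "j \<le> m" by simp
    have tj: "t j \<le> s" "s < t (Suc j)"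
      using j N by (auto simp: t_def field_simps)
    define \<mu> where "\<mu> = (s - t j) * real N"
    have \<mu>: "0 \<le> \<mu>" "\<mu> \<le> 1"
    proof -
      show "0 \<le> \<mu>" using tj by (simp add: \<mu>_def)
      have "\<mu> \<le> (t (Suc j) - t j) * real N"
        unfolding \<mu>_def using tj by (intro mult_right_mono) auto
      then show "\<mu> \<le> 1" using step N by simp
    qed
    have "(\<Sum>k<m. (\<sigma> (Suc k) - \<sigma> k) * max 0 (s - t (Suc k)))
        = (\<Sum>k<j. (\<sigma> (Suc k) - \<sigma> k) * (s - t (Suc k)))"
    proof (rule sum.mono_neutral_cong_right)
      show "\<forall>k\<in>{..<m} - {..<j}. (\<sigma> (Suc k) - \<sigma> k) * max 0 (s - t (Suc k)) = 0"
      proof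
        fix k assume "k \<in> {..<m} - {..<j}"
        then have "t (Suc j) \<le> t (Suc k)" using mono_t by simp
        with tj show "(\<sigma> (Suc k) - \<sigma> k) * max 0 (s - t (Suc k)) = 0" by simp
      qed
      fix k assume "k \<in> {..<j}"
      then have "t (Suc k) \<le> t j" using mono_t by simp
      with tj show "(\<sigma> (Suc k) - \<sigma> k) * max 0 (s - t (Suc k)) = (\<sigma> (Suc k) - \<sigma> k) * (s - t (Suc k))"
        by simp
    qed (use jm in auto)
    then have "\<phi> (t 0) - \<sigma> 0 * t 0 + \<sigma> 0 * s + (\<Sum>k<m. (\<sigma> (Suc k) - \<sigma> k) * max 0 (s - t (Suc k)))
        = \<phi> (t j) + \<sigma> j * (s - t j)"
      using interp[of s j] by (simp add: algebra_simps)
    also have "\<dots> = (1 - \<mu>) * \<phi> (t j) + \<mu> * \<phi> (t (Suc j))"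
      by (simp add: \<mu>_def \<sigma>_def algebra_simps)
    finally show "\<exists>y z \<mu>. \<bar>y - s\<bar> \<le> 1 / N \<and> \<bar>z - s\<bar> \<le> 1 / N \<and> 0 \<le> \<mu> \<and> \<mu> \<le> 1 \<and>
      \<phi> (t 0) - \<sigma> 0 * t 0 + \<sigma> 0 * s + (\<Sum>k<m. (\<sigma> (Suc k) - \<sigma> k) * max 0 (s - t (Suc k)))
        = (1 - \<mu>) * \<phi> y + \<mu> * \<phi> z"
      using tj step[of j] \<mu> by (intro exI[of _ "t j"] exI[of _ "t (Suc j)"] exI[of _ \<mu>]) auto
  qed (rule slopes)
qed

section \<open>Gaussian limits and integrals\<close>

text \<open>This is the central limit theorem for fair signs, read off from characteristic
  functions. The expansion is carried out for positive \<open>t\<close>; evenness gives the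
  rest.\<close>

lemma cos_power_tendsto_exp:
  "(\<lambda>N. cos (t / sqrt (real N)) ^ N) \<longlonglongrightarrow> exp (- (t ^ 2) / 2)"
proof -
  have pos: "(\<lambda>N. cos (t / sqrt (real N)) ^ N) \<longlonglongrightarrow> exp (- (t ^ 2) / 2)" if "t > 0" for t :: real
  proof -
    have "(\<lambda>N. cos (t / sqrt (real N)) ^ N) \<longlonglongrightarrow> exp (- (t * t) / 2)"
      using that by real_asymp
    then show ?thesis by (simp add: power2_eq_square)
  qed
  consider "t > 0" | "t = 0" | "t < 0" by linarith
  then show ?thesis
  proof cases
    case 3
    with pos[of "- t"] show ?thesis by simp
  qed (use pos in auto)
qed

definition gauss :: "'a::euclidean_space \<Rightarrow> real" where
  "gauss y = exp (- (norm y)\<^sup>2 / 2)"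

lemma continuous_on_gauss: "continuous_on S gauss"
  unfolding gauss_def[abs_def] by (intro continuous_intros) auto

lemma gauss_measurable [measurable]: "gauss \<in> borel_measurable borel"
  by (intro borel_measurable_continuous_onI continuous_on_gauss)

lemma gauss_pos: "0 < gauss y"
  by (simp add: gauss_def)

lemma norm_sum_Basis: "(norm y)\<^sup>2 = (\<Sum>b\<in>Basis. (y \<bullet> b)\<^sup>2)"
  unfolding power2_norm_eq_inner by (subst euclidean_inner) (simp add: power2_eq_square)

lemma gauss_prod: "gauss y = (\<Prod>b\<in>Basis. exp (- (y \<bullet> b)\<^sup>2 / 2))"
  unfolding gauss_def norm_sum_Basis
  by (subst exp_sum[symmetric]) (simp_all add: sum_divide_distrib sum_negf)

text \<open>Turns the coordinate bound for the norm into a product over coordinates, whose integral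
  against a Gaussian factorises.\<close>

lemma one_plus_sum_le_prod:
  fixes f :: "'b \<Rightarrow> real"
  assumes "finite I" "\<And>i. i \<in> I \<Longrightarrow> 0 \<le> f i"
  shows "1 + (\<Sum>i\<in>I. f i) \<le> (\<Prod>i\<in>I. 1 + f i)"
  using assms
proof (induction I rule: finite_induct)
  case (insert i I)
  have "1 + (\<Sum>i\<in>insert i I. f i) \<le> (1 + f i) * (1 + (\<Sum>i\<in>I. f i))"
    using insert by (simp add: algebra_simps sum_nonneg)
  also have "\<dots> \<le> (1 + f i) * (\<Prod>i\<in>I. 1 + f i)"
    using insert by (intro mult_left_mono) auto
  finally show ?case using insert by simp
qed simp

text \<open>The integrand is dominated by a product of one-variable functions \<open>f\<close>, so
  the integral reduces to the zeroth and first absolute moments of the normal distribution.\<close>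

lemma integrable_one_plus_norm_gauss:
  "integrable lborel (\<lambda>y :: 'a::euclidean_space. (1 + norm y) * gauss y)"
proof (rule integrableI_nonneg)
  define f where "f = (\<lambda>t :: real. (1 + \<bar>t\<bar>) * exp (- t\<^sup>2 / 2))"
  have f: "0 \<le> f t" for t
    by (simp add: f_def)
  have meas: "f \<in> borel_measurable borel"
    unfolding f_def by measurable
  have "integrable lborel (\<lambda>t. sqrt (2 * pi) * (std_normal_density t * \<bar>t\<bar> ^ 0 + std_normal_density t * \<bar>t\<bar> ^ 1))"
    by (intro integrable_mult_right Bochner_Integration.integrable_add integrable_std_normal_moment_abs)
  also have "(\<lambda>t. sqrt (2 * pi) * (std_normal_density t * \<bar>t\<bar> ^ 0 + std_normal_density t * \<bar>t\<bar> ^ 1)) = f"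
    by (simp add: f_def std_normal_density_def fun_eq_iff field_simps)
  finally have "integrable lborel f" .
  then have fin: "(\<integral>\<^sup>+t. ennreal (f t) \<partial>lborel) < \<infinity>"
    using f by (simp add: integrable_iff_bounded)
  have le: "(1 + norm y) * gauss y \<le> (\<Prod>b\<in>Basis. f (y \<bullet> b))" for y :: 'a
  proof -
    have "1 + norm y \<le> 1 + (\<Sum>b\<in>Basis. \<bar>y \<bullet> b\<bar>)"
      using norm_le_l1[of y] by simp
    also have "\<dots> \<le> (\<Prod>b\<in>Basis. 1 + \<bar>y \<bullet> b\<bar>)"
      by (rule one_plus_sum_le_prod) auto
    finally have "(1 + norm y) * gauss y \<le> (\<Prod>b\<in>Basis. 1 + \<bar>y \<bullet> b\<bar>) * gauss y"
      using gauss_pos[of y] by (intro mult_right_mono) auto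
    then show ?thesis
      by (simp add: gauss_prod f_def prod.distrib)
  qed
  have "(\<integral>\<^sup>+y. ennreal ((1 + norm y) * gauss y) \<partial>(lborel :: 'a measure))
      \<le> (\<integral>\<^sup>+y. (\<Prod>b\<in>Basis. ennreal (f (y \<bullet> b))) \<partial>(lborel :: 'a measure))"
  proof (rule nn_integral_mono)
    fix y :: 'a
    show "ennreal ((1 + norm y) * gauss y) \<le> (\<Prod>b\<in>Basis. ennreal (f (y \<bullet> b)))"
      using le[of y] f by (simp add: prod_ennreal ennreal_leI)
  qed
  also have "\<dots> = (\<Prod>b\<in>(Basis :: 'a set). (\<integral>\<^sup>+t. ennreal (f t) \<partial>lborel))"
    using meas by (subst nn_integral_lborel_prod) auto
  also have "\<dots> < \<infinity>"
    using fin by (simp add: less_top[symmetric] power_eq_top_ennreal)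
  finally show "(\<integral>\<^sup>+y. ennreal ((1 + norm y) * gauss (y :: 'a)) \<partial>lborel) < \<infinity>" .
qed (use gauss_pos in \<open>auto intro!: AE_I2 mult_nonneg_nonneg less_imp_le[OF gauss_pos]\<close>)

lemma integrable_gauss_bound:
  fixes h :: "'a::euclidean_space \<Rightarrow> real"
  assumes [measurable]: "h \<in> borel_measurable borel" and le: "\<And>y. \<bar>h y\<bar> \<le> A + B * norm y"
  shows "integrable lborel (\<lambda>y. h y * gauss y)"
proof (rule Bochner_Integration.integrable_bound)
  show "integrable lborel (\<lambda>y :: 'a. max \<bar>A\<bar> \<bar>B\<bar> * ((1 + norm y) * gauss y))"
    by (intro integrable_mult_right integrable_one_plus_norm_gauss)
  show "AE y in lborel. norm (h y * gauss y) \<le> norm (max \<bar>A\<bar> \<bar>B\<bar> * ((1 + norm y) * gauss y))"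
  proof (rule AE_I2)
    fix y :: 'a
    have "B \<le> max \<bar>A\<bar> \<bar>B\<bar>" "A \<le> max \<bar>A\<bar> \<bar>B\<bar>"
      by auto
    then have "\<bar>h y\<bar> \<le> max \<bar>A\<bar> \<bar>B\<bar> + max \<bar>A\<bar> \<bar>B\<bar> * norm y"
      using norm_ge_zero[of y] le[of y] mult_right_mono[of B "max \<bar>A\<bar> \<bar>B\<bar>" "norm y"] by linarith
    then have "\<bar>h y\<bar> * gauss y \<le> max \<bar>A\<bar> \<bar>B\<bar> * (1 + norm y) * gauss y"
      using gauss_pos[of y] by (intro mult_right_mono) (auto simp: algebra_simps)
    then show "norm (h y * gauss y) \<le> norm (max \<bar>A\<bar> \<bar>B\<bar> * ((1 + norm y) * gauss y))"
      using gauss_pos[of y] by (simp add: abs_mult mult_ac)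
  qed
qed measurable

lemma integral_gauss_pos: "0 < (\<integral>y. gauss y \<partial>(lborel :: 'a::euclidean_space measure))"
proof -
  have int: "integrable lborel (gauss :: 'a \<Rightarrow> real)"
    using integrable_gauss_bound[of "\<lambda>_. 1" 1 0] by simp
  have nn: "AE y in lborel. 0 \<le> gauss (y :: 'a)"
    by (intro AE_I2 less_imp_le gauss_pos)
  have "(\<integral>y. gauss y \<partial>(lborel :: 'a measure)) \<noteq> 0"
  proof
    assume "(\<integral>y. gauss y \<partial>(lborel :: 'a measure)) = 0"
    then have "AE y in lborel. gauss (y :: 'a) = 0"
      using integral_nonneg_eq_0_iff_AE[OF int nn] by simp
    then have "AE y in (lborel :: 'a measure). False"
      by eventually_elim (use gauss_pos in \<open>metis less_irrefl\<close>)
    then show False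
      by (simp add: AE_iff_measurable[OF _ refl])
  qed
  moreover have "0 \<le> (\<integral>y. gauss y \<partial>(lborel :: 'a measure))"
    using nn by (rule integral_nonneg_AE)
  ultimately show ?thesis by simp
qed

section \<open>Convexity of integrals and of explicit one-variable functions\<close>

lemma Conv_integral:
  fixes v :: "'b \<Rightarrow> 'a::euclidean_space \<Rightarrow> real"
  assumes "\<And>y. v y \<in> Conv" "\<And>x. integrable M (\<lambda>y. v y x)"
  shows "(\<lambda>x. \<integral>y. v y x \<partial>M) \<in> Conv"
proof (rule ConvI)
  fix x1 x2 :: 'a and t :: real
  assume t: "0 \<le> t" "t \<le> 1"
  have "(\<integral>y. v y ((1 - t) *\<^sub>R x1 + t *\<^sub>R x2) \<partial>M) \<le> (\<integral>y. (1 - t) * v y x1 + t * v y x2 \<partial>M)"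
    using assms(2) ConvD[OF assms(1) t] by (intro integral_mono) auto
  also have "\<dots> = (1 - t) * (\<integral>y. v y x1 \<partial>M) + t * (\<integral>y. v y x2 \<partial>M)"
    using assms(2) by simp
  finally show "(\<integral>y. v y ((1 - t) *\<^sub>R x1 + t *\<^sub>R x2) \<partial>M)
      \<le> (1 - t) * (\<integral>y. v y x1 \<partial>M) + t * (\<integral>y. v y x2 \<partial>M)" .
qed

lemma Conv_real_second_derivative:
  fixes f :: "real \<Rightarrow> real"
  assumes "\<And>x. (f has_real_derivative f' x) (at x)" "\<And>x. (f' has_real_derivative f'' x) (at x)"
    and "\<And>x. 0 \<le> f'' x"
  shows "f \<in> Conv"
  unfolding Conv_def using f''_ge0_imp_convex[of UNIV f f' f''] assms by simp

text \<open>The square compensates the concave parts of the cosine: the second derivative is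
  \<open>c * (1 - cos (s - \<beta>))\<close>.\<close>

lemma Conv_cos_plus_square:
  assumes "0 \<le> c"
  shows "(\<lambda>s :: real. c * (cos (s - \<beta>) + (s - \<beta>)\<^sup>2 / 2)) \<in> Conv"
proof (rule Conv_real_second_derivative)
  fix s :: real
  show "((\<lambda>s. c * (cos (s - \<beta>) + (s - \<beta>)\<^sup>2 / 2)) has_real_derivative c * (- sin (s - \<beta>) + (s - \<beta>))) (at s)"
    by (rule derivative_eq_intros refl | simp)+
  show "((\<lambda>s. c * (- sin (s - \<beta>) + (s - \<beta>))) has_real_derivative c * (- cos (s - \<beta>) + 1)) (at s)"
    by (rule derivative_eq_intros refl | simp)+
  show "0 \<le> c * (- cos (s - \<beta>) + 1)"
    using assms by simp
qed

lemma Conv_square: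
  assumes "0 \<le> c"
  shows "(\<lambda>s :: real. c * (s - \<beta>)\<^sup>2) \<in> Conv"
proof (rule Conv_real_second_derivative)
  fix s :: real
  show "((\<lambda>s. c * (s - \<beta>)\<^sup>2) has_real_derivative 2 * c * (s - \<beta>)) (at s)"
    by (rule derivative_eq_intros refl | simp)+
  show "((\<lambda>s. 2 * c * (s - \<beta>)) has_real_derivative 2 * c) (at s)"
    by (rule derivative_eq_intros refl | simp)+
qed (use assms in simp)

lemma lborel_integral_affine:
  fixes h :: "'a::euclidean_space \<Rightarrow> real"
  assumes [measurable]: "h \<in> borel_measurable borel" and c: "c \<noteq> 0"
  shows "(\<integral>y. h y \<partial>lborel) = \<bar>c\<bar> ^ DIM('a) * (\<integral>z. h (t + c *\<^sub>R z) \<partial>lborel)"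
proof -
  have "(\<integral>y. h y \<partial>lborel)
      = (\<integral>y. h y \<partial>density (distr lborel borel (\<lambda>x. t + c *\<^sub>R x)) (\<lambda>_. \<bar>c\<bar> ^ DIM('a)))"
    using lborel_affine[OF c, of t] by simp
  also have "\<dots> = \<bar>c\<bar> ^ DIM('a) * (\<integral>z. h (t + c *\<^sub>R z) \<partial>lborel)"
    by (subst integral_density) (auto simp: integral_distr)
  finally show ?thesis .
qed

section \<open>Functionals invariant under adding hinges\<close>

locale hinge_invariant =
  fixes Y :: "('a::euclidean_space \<Rightarrow> real) \<Rightarrow> real"
  assumes Y: "invariant_valuation Y"
    and hinge: "u \<in> Conv \<Longrightarrow> Y (\<lambda>x. u x + hinge a \<alpha> x) = Y u"
begin

text \<open>The goal of the locale is that every convex function is null. Sums, pointwise limits and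
  cancellation are the ways to produce new null functions.\<close>

definition null :: "('a \<Rightarrow> real) \<Rightarrow> bool" where
  "null w \<longleftrightarrow> w \<in> Conv \<and> (\<forall>u\<in>Conv. Y (\<lambda>x. u x + w x) = Y u)"

lemma null_Conv: "null w \<Longrightarrow> w \<in> Conv"
  by (simp add: null_def)

lemma null_add:
  assumes "null v" "null w"
  shows "null (\<lambda>x. v x + w x)"
proof -
  have "Y (\<lambda>x. (u x + v x) + w x) = Y u" if "u \<in> Conv" for u
    using assms that Conv_add[OF that, of v] by (simp add: null_def)
  then show ?thesis
    using assms Conv_add[of v w] by (simp add: null_def add.assoc)
qed

lemma null_affine: "null (\<lambda>x. a \<bullet> x + c)"
  using invariant_valuation_affine[OF Y, of _ a c] Conv_inner_add[OF Conv_const[of 0], of a c]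
  by (simp add: null_def add.assoc)

lemma null_sum:
  "finite I \<Longrightarrow> (\<And>i. i \<in> I \<Longrightarrow> null (f i)) \<Longrightarrow> null (\<lambda>x. \<Sum>i\<in>I. f i x)"
proof (induction I rule: finite_induct)
  case empty
  show ?case using null_affine[of 0 0] by simp
qed (simp add: null_add)

lemma null_limit:
  assumes null: "\<And>k::nat. null (ws k)" and lim: "\<And>x. (\<lambda>k. ws k x) \<longlonglongrightarrow> w x"
  shows "null w"
proof -
  have ws: "ws k \<in> Conv" for k
    using null by (rule null_Conv)
  then have w: "w \<in> Conv"
    using lim by (rule Conv_pointwise_limit)
  have "Y (\<lambda>x. u x + w x) = Y u" if u: "u \<in> Conv" for u
  proof -
    have "(\<lambda>k. Y (\<lambda>x. u x + ws k x)) \<longlonglongrightarrow> Y (\<lambda>x. u x + w x)"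
      by (rule epi_continuousD[OF invariant_valuation_epi_continuous[OF Y]])
        (intro Conv_add u w ws tendsto_add tendsto_const lim)+
    moreover have "Y (\<lambda>x. u x + ws k x) = Y u" for k
      using null u by (simp add: null_def)
    ultimately show ?thesis
      by (simp add: LIMSEQ_const_iff)
  qed
  with w show ?thesis by (simp add: null_def)
qed

text \<open>Substitute for subtraction: \<open>Y\<close> is controlled only on \<open>Conv\<close>,
  so a difference of null functions has to be known to be convex before it can be called
  null.\<close>

lemma null_cancel:
  assumes "null w" "v \<in> Conv" "null (\<lambda>x. v x + w x)"
  shows "null v"
proof -
  have "Y (\<lambda>x. u x + v x) = Y u" if u: "u \<in> Conv" for u
  proof -
    have "Y (\<lambda>x. u x + v x) = Y (\<lambda>x. (u x + v x) + w x)"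
      using assms(1) Conv_add[OF u assms(2)] by (simp add: null_def)
    also have "\<dots> = Y u"
      using assms(3) u by (simp add: null_def add.assoc)
    finally show ?thesis .
  qed
  with assms(2) show ?thesis by (simp add: null_def)
qed

section \<open>Ridge functions and Gaussians are null\<close>

lemma null_cmul_hinge:
  assumes "0 \<le> c"
  shows "null (\<lambda>x. c * max 0 (a \<bullet> x - \<alpha>))"
proof -
  have "null (hinge (c *\<^sub>R a) (c * \<alpha>))"
    using hinge by (simp add: null_def Conv_hinge)
  also have "hinge (c *\<^sub>R a) (c * \<alpha>) = (\<lambda>x. c * max 0 (a \<bullet> x - \<alpha>))"
    using assms by (auto simp: hinge_def fun_eq_iff max_mult_distrib_left algebra_simps)
  finally show ?thesis .
qed

text \<open>Piecewise linear interpolants of \<open>\<phi>\<close> are affine functions plus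
  nonnegative combinations of hinges, hence null, and they converge pointwise.\<close>

lemma null_ridge:
  assumes \<phi>: "\<phi> \<in> Conv"
  shows "null (\<lambda>x. \<phi> (a \<bullet> x))"
proof -
  \<comment> \<open>Each value of \<open>S\<close> is a convex combination of values of
    \<open>\<phi>\<close> at points within \<open>1 / Suc N\<close>, so continuity of
    \<open>\<phi>\<close> at \<open>s\<close> gives the convergence.\<close>
  define approx where "approx = (\<lambda>(N::nat) S. \<forall>s. \<bar>s\<bar> \<le> real (Suc N) \<longrightarrow>
    (\<exists>y z \<mu>. \<bar>y - s\<bar> \<le> 1 / Suc N \<and> \<bar>z - s\<bar> \<le> 1 / Suc N \<and> 0 \<le> \<mu> \<and> \<mu> \<le> 1 \<and>
      S s = (1 - \<mu>) * \<phi> y + \<mu> * \<phi> z))"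
  have "\<exists>S. null (\<lambda>x. S (a \<bullet> x)) \<and> approx N S" for N
  proof (rule Conv_real_max_approximation[OF \<phi> zero_less_Suc[of N]])
    fix c t :: "nat \<Rightarrow> real" and p q m
    assume c: "\<And>k. 0 \<le> c k"
      and S: "\<And>s. \<bar>s\<bar> \<le> real (Suc N) \<Longrightarrow>
        \<exists>y z \<mu>. \<bar>y - s\<bar> \<le> 1 / Suc N \<and> \<bar>z - s\<bar> \<le> 1 / Suc N \<and> 0 \<le> \<mu> \<and> \<mu> \<le> 1 \<and>
        p + q * s + (\<Sum>k<m. c k * max 0 (s - t k)) = (1 - \<mu>) * \<phi> y + \<mu> * \<phi> z"
    have "null (\<lambda>x. ((q *\<^sub>R a) \<bullet> x + p) + (\<Sum>k<m. c k * max 0 (a \<bullet> x - t k)))"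
      by (intro null_add null_affine null_sum null_cmul_hinge c) simp
    then have "null (\<lambda>x. p + q * (a \<bullet> x) + (\<Sum>k<m. c k * max 0 (a \<bullet> x - t k)))"
      by (simp add: add_ac)
    moreover have "approx N (\<lambda>s. p + q * s + (\<Sum>k<m. c k * max 0 (s - t k)))"
      unfolding approx_def using S by blast
    ultimately show ?thesis
      by (intro exI[of _ "\<lambda>s. p + q * s + (\<Sum>k<m. c k * max 0 (s - t k))"] conjI)
  qed
  then obtain S where null: "\<And>N. null (\<lambda>x. S N (a \<bullet> x))" and approx: "\<And>N. approx N (S N)"
    by metis
  have "(\<lambda>N. S N s) \<longlonglongrightarrow> \<phi> s" for s
  proof (rule LIMSEQ_I)
    fix e :: real assume e: "0 < e"
    obtain d where d: "0 < d" "\<And>y. \<bar>y - s\<bar> < d \<Longrightarrow> \<bar>\<phi> y - \<phi> s\<bar> < e"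
      using Conv_isCont[OF \<phi>, of s] e unfolding continuous_at_eps_delta by (auto simp: dist_real_def)
    obtain N1 :: nat where N1: "1 / Suc N1 < d"
      using d(1) nat_approx_posE by blast
    obtain N2 :: nat where N2: "\<bar>s\<bar> \<le> real N2"
      using real_arch_simple by blast
    show "\<exists>N0. \<forall>N\<ge>N0. norm (S N s - \<phi> s) < e"
    proof (intro exI allI impI)
      fix N assume N: "max N1 N2 \<le> N"
      then have "\<bar>s\<bar> \<le> real (Suc N)"
        using N2 by simp
      then obtain y z \<mu> where yz: "\<bar>y - s\<bar> \<le> 1 / Suc N" "\<bar>z - s\<bar> \<le> 1 / Suc N"
        and \<mu>: "0 \<le> \<mu>" "\<mu> \<le> 1" and Seq: "S N s = (1 - \<mu>) * \<phi> y + \<mu> * \<phi> z"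
        using approx[of N] unfolding approx_def by blast
      have "1 / Suc N \<le> 1 / Suc N1"
        using N by (simp add: frac_le)
      then have "\<bar>\<phi> y - \<phi> s\<bar> < e" "\<bar>\<phi> z - \<phi> s\<bar> < e"
        using yz N1 d(2) by auto
      then have "\<phi> y \<in> {\<phi> s - e<..<\<phi> s + e}" "\<phi> z \<in> {\<phi> s - e<..<\<phi> s + e}"
        by auto
      then have "(1 - \<mu>) *\<^sub>R \<phi> y + \<mu> *\<^sub>R \<phi> z \<in> {\<phi> s - e<..<\<phi> s + e}"
        using \<mu> by (intro convexD[OF convex_real_interval(8)]) auto
      then show "norm (S N s - \<phi> s) < e"
        by (auto simp: Seq)
    qed
  qed
  then show ?thesis
    by (rule null_limit[OF null])
qed

text \<open>By \<open>2 cos b cos a = cos (b + a) + cos (b - a)\<close> and the parallelogram law, the function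
  below is an average of functions of the form \<open>cos s + s\<^sup>2 / 2\<close> with \<open>s\<close> affine in \<open>x\<close>.\<close>

lemma null_cos_prod:
  assumes "0 \<le> c"
  shows "null (\<lambda>x. c * (cos (b \<bullet> (x - z)) * prod_list (map (\<lambda>a. cos (a \<bullet> (x - z))) as)
      + ((b \<bullet> (x - z))\<^sup>2 + sum_list (map (\<lambda>a. (a \<bullet> (x - z))\<^sup>2) as)) / 2))"
  using assms
\<comment> \<open>The frequency \<open>b\<close> absorbs the vectors of the list one at a time,
  becoming \<open>b + a\<close> or \<open>b - a\<close>; \<open>null_gauss\<close> starts from
  \<open>b = 0\<close>.\<close>
proof (induction as arbitrary: b c)
  case Nil
  then show ?case
    using null_ridge[OF Conv_cos_plus_square[of c "b \<bullet> z"], of b] by (simp add: inner_diff_right)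
next
  case (Cons a as)
  let ?P = "\<lambda>b x. cos (b \<bullet> (x - z)) * prod_list (map (\<lambda>a. cos (a \<bullet> (x - z))) as)
      + ((b \<bullet> (x - z))\<^sup>2 + sum_list (map (\<lambda>a. (a \<bullet> (x - z))\<^sup>2) as)) / 2"
  have "null (\<lambda>x. c / 2 * ?P (b + a) x + c / 2 * ?P (b - a) x)"
    using Cons.IH[of "c / 2"] Cons.prems by (intro null_add) simp_all
  also have "(\<lambda>x. c / 2 * ?P (b + a) x + c / 2 * ?P (b - a) x) =
    (\<lambda>x. c * (cos (b \<bullet> (x - z)) * prod_list (map (\<lambda>a. cos (a \<bullet> (x - z))) (a # as))
      + ((b \<bullet> (x - z))\<^sup>2 + sum_list (map (\<lambda>a. (a \<bullet> (x - z))\<^sup>2) (a # as))) / 2))"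
  proof
    fix x
    have ba: "(b + a) \<bullet> (x - z) = b \<bullet> (x - z) + a \<bullet> (x - z)"
      "(b - a) \<bullet> (x - z) = b \<bullet> (x - z) - a \<bullet> (x - z)"
      by (simp_all add: inner_add_left inner_diff_left)
    have id: "c / 2 * ((cb * ca - sb * sa) * p + ((b + a)\<^sup>2 + q) / 2)
        + c / 2 * ((cb * ca + sb * sa) * p + ((b - a)\<^sup>2 + q) / 2)
        = c * (cb * (ca * p) + (b\<^sup>2 + (a\<^sup>2 + q)) / 2)" for ca cb sa sb p q a b :: real
      by (simp add: power2_eq_square field_simps)
    show "c / 2 * ?P (b + a) x + c / 2 * ?P (b - a) x = c * (cos (b \<bullet> (x - z)) *
        prod_list (map (\<lambda>a. cos (a \<bullet> (x - z))) (a # as))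
      + ((b \<bullet> (x - z))\<^sup>2 + sum_list (map (\<lambda>a. (a \<bullet> (x - z))\<^sup>2) (a # as))) / 2)"
      unfolding ba cos_add cos_diff list.map prod_list.Cons sum_list.Cons by (rule id)
  qed
  finally show ?case .
qed

lemma null_norm_square:
  assumes "0 \<le> c"
  shows "null (\<lambda>x. c * (norm (x - z))\<^sup>2)"
proof -
  have "null (\<lambda>x. \<Sum>b\<in>Basis. c * (b \<bullet> x - b \<bullet> z)\<^sup>2)"
    by (intro null_sum null_ridge[OF Conv_square[OF assms]]) simp
  also have "(\<lambda>x. \<Sum>b\<in>Basis. c * (b \<bullet> x - b \<bullet> z)\<^sup>2) = (\<lambda>x. c * (norm (x - z))\<^sup>2)"
    by (simp add: norm_sum_Basis sum_distrib_left inner_diff_right inner_commute[of "x - z" for x])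
  finally show ?thesis .
qed

text \<open>In \<open>null_cos_prod\<close> use \<open>N\<close> copies of
  \<open>(s / sqrt N) *\<^sub>R b\<close> for every basis vector \<open>b\<close>. The product of
  cosines tends to the Gaussian, while the squares add up exactly to the squared norm.\<close>

lemma null_gauss:
  assumes c: "0 \<le> c"
  shows "null (\<lambda>x. c * (gauss (s *\<^sub>R (x - z)) + (norm (s *\<^sub>R (x - z)))\<^sup>2 / 2))"
proof -
  obtain bs :: "'a list" where bs: "set bs = Basis" "distinct bs"
    using finite_distinct_list[OF finite_Basis] by blast
  define as where "as = (\<lambda>N. concat (map (\<lambda>b. replicate N ((s / sqrt (real N)) *\<^sub>R b)) bs))"
  have prods: "prod_list (map f (as N)) = (\<Prod>b\<in>Basis. f ((s / sqrt (real N)) *\<^sub>R b) ^ N)"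
    for f :: "'a \<Rightarrow> real" and N
  proof -
    have "prod_list (map f (as N)) = prod_list (map (\<lambda>b. f ((s / sqrt (real N)) *\<^sub>R b) ^ N) bs)"
      unfolding as_def by (induction bs) (simp_all add: prod_list_replicate)
    also have "\<dots> = (\<Prod>b\<in>Basis. f ((s / sqrt (real N)) *\<^sub>R b) ^ N)"
      using bs by (metis prod.distinct_set_conv_list)
    finally show ?thesis .
  qed
  have sums: "sum_list (map f (as N)) = (\<Sum>b\<in>Basis. real N * f ((s / sqrt (real N)) *\<^sub>R b))"
    for f :: "'a \<Rightarrow> real" and N
  proof -
    have "sum_list (map f (as N)) = sum_list (map (\<lambda>b. real N * f ((s / sqrt (real N)) *\<^sub>R b)) bs)"
      unfolding as_def by (induction bs) (simp_all add: sum_list_replicate)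
    also have "\<dots> = (\<Sum>b\<in>Basis. real N * f ((s / sqrt (real N)) *\<^sub>R b))"
      using bs by (metis sum.distinct_set_conv_list)
    finally show ?thesis .
  qed
  show ?thesis
  proof (rule null_limit)
    \<comment> \<open>With \<open>Suc N\<close> copies the number of repetitions is positive, so the
      identity for the squares holds for every index.\<close>
    fix N
    show "null (\<lambda>x. c * (cos (0 \<bullet> (x - z)) * prod_list (map (\<lambda>a. cos (a \<bullet> (x - z))) (as (Suc N)))
      + ((0 \<bullet> (x - z))\<^sup>2 + sum_list (map (\<lambda>a. (a \<bullet> (x - z))\<^sup>2) (as (Suc N)))) / 2))"
      by (rule null_cos_prod[OF c])
  next
    fix x
    define y where "y = s *\<^sub>R (x - z)"
    have "(\<lambda>N. \<Prod>b\<in>Basis. cos ((y \<bullet> b) / sqrt (real N)) ^ N) \<longlonglongrightarrow> gauss y"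
      unfolding gauss_prod by (intro tendsto_prod cos_power_tendsto_exp)
    then have "(\<lambda>N. \<Prod>b\<in>Basis. cos ((y \<bullet> b) / sqrt (real (Suc N))) ^ Suc N) \<longlonglongrightarrow> gauss y"
      by (rule LIMSEQ_Suc)
    then have lim: "(\<lambda>N. c * ((\<Prod>b\<in>Basis. cos ((y \<bullet> b) / sqrt (real (Suc N))) ^ Suc N) + (norm y)\<^sup>2 / 2))
        \<longlonglongrightarrow> c * (gauss y + (norm y)\<^sup>2 / 2)"
      by (intro tendsto_intros)
    have inner: "((s / sqrt (real N)) *\<^sub>R b) \<bullet> (x - z) = (y \<bullet> b) / sqrt (real N)" for N b
      by (simp add: y_def inner_commute)
    have "(\<Sum>b\<in>Basis. real (Suc N) * ((y \<bullet> b) / sqrt (real (Suc N)))\<^sup>2) = (norm y)\<^sup>2" for N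
      unfolding norm_sum_Basis by (simp add: power_divide)
    then show "(\<lambda>N. c * (cos (0 \<bullet> (x - z)) * prod_list (map (\<lambda>a. cos (a \<bullet> (x - z))) (as (Suc N)))
      + ((0 \<bullet> (x - z))\<^sup>2 + sum_list (map (\<lambda>a. (a \<bullet> (x - z))\<^sup>2) (as (Suc N)))) / 2))
      \<longlonglongrightarrow> c * (gauss (s *\<^sub>R (x - z)) + (norm (s *\<^sub>R (x - z)))\<^sup>2 / 2)"
      using lim unfolding prods sums inner y_def[symmetric] by simp
  qed
qed

text \<open>Replacing \<open>z\<close> by a simple function \<open>q i z\<close> turns the integral
  into a finite sum of translates of \<open>G\<close>, weighted by the nonnegative integrals of
  \<open>F\<close> over the level sets. Dominated convergence then yields the limit.\<close>

lemma null_integral: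
  fixes F G :: "'a \<Rightarrow> real"
  assumes G: "\<And>c z. 0 \<le> c \<Longrightarrow> null (\<lambda>x. c * G (x - z))" and contG: "continuous_on UNIV G"
    and F: "integrable lborel F" "\<And>z. 0 \<le> F z" "\<And>z. R < norm z \<Longrightarrow> F z = 0"
  shows "null (\<lambda>x. \<integral>z. F z * G (x - z) \<partial>lborel)"
proof -
  have [measurable]: "F \<in> borel_measurable borel" "G \<in> borel_measurable borel"
    using F(1) contG by (auto intro: borel_measurable_continuous_onI)
  have "(\<lambda>x. x) \<in> borel_measurable (lborel :: 'a measure)"
    by simp
  from borel_measurable_implies_sequence_metric[OF this, of 0]
  obtain q where q: "\<And>i. simple_function lborel (q i)" "\<And>z. (\<lambda>i. q i z) \<longlonglongrightarrow> (z :: 'a)"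
    "\<And>i z. norm (q i z) \<le> 2 * norm z"
    by auto
  have [measurable]: "q i \<in> borel_measurable borel" for i
    using borel_measurable_simple_function[OF q(1)] by simp
  show ?thesis
  proof (rule null_limit)
    fix i
    define A where "A = (\<lambda>y. q i -` {y})"
    have fin: "finite (range (q i))"
      using simple_functionD(1)[OF q(1)] by simp
    have A [measurable]: "A y \<in> sets lborel" for y
      using simple_functionD(2)[OF q(1), of i "{y}"] by (simp add: A_def)
    have "null (\<lambda>x. \<Sum>y\<in>range (q i). (\<integral>z. F z * indicator (A y) z \<partial>lborel) * G (x - y))"
      using F(2) by (intro null_sum fin G integral_nonneg_AE AE_I2) auto
    also have "(\<lambda>x. \<Sum>y\<in>range (q i). (\<integral>z. F z * indicator (A y) z \<partial>lborel) * G (x - y))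
        = (\<lambda>x. \<integral>z. F z * G (x - q i z) \<partial>lborel)"
    proof
      fix x
      have "(\<Sum>y\<in>range (q i). (\<integral>z. F z * indicator (A y) z \<partial>lborel) * G (x - y))
          = (\<integral>z. (\<Sum>y\<in>range (q i). F z * indicator (A y) z * G (x - y)) \<partial>lborel)"
        using A F(1) by (subst Bochner_Integration.integral_sum)
          (auto intro!: integrable_mult_left integrable_real_mult_indicator simp: mult.commute)
      also have "(\<lambda>z. \<Sum>y\<in>range (q i). F z * indicator (A y) z * G (x - y)) = (\<lambda>z. F z * G (x - q i z))"
      proof
        fix z
        have "(\<Sum>y\<in>range (q i). F z * indicator (A y) z * G (x - y))
            = (\<Sum>y\<in>{q i z}. F z * indicator (A y) z * G (x - y))"
          by (intro sum.mono_neutral_right fin) (auto simp: A_def)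
        then show "(\<Sum>y\<in>range (q i). F z * indicator (A y) z * G (x - y)) = F z * G (x - q i z)"
          by (simp add: A_def)
      qed
      finally show "(\<Sum>y\<in>range (q i). (\<integral>z. F z * indicator (A y) z \<partial>lborel) * G (x - y))
          = (\<integral>z. F z * G (x - q i z) \<partial>lborel)" .
    qed
    finally show "null (\<lambda>x. \<integral>z. F z * G (x - q i z) \<partial>lborel)" .
  next
    fix x :: 'a
    \<comment> \<open>Where \<open>F\<close> does not vanish,
      \<open>norm (q i z) \<le> 2 * |R|\<close>. So all arguments \<open>x - q i z\<close> lie in
      this ball, and a bound for \<open>G\<close> on it gives the dominating function.\<close>
    have "bounded (G ` cball 0 (norm x + 2 * \<bar>R\<bar>))"
      by (intro compact_imp_bounded compact_continuous_image continuous_on_subset[OF contG]) auto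
    then obtain B where "\<forall>t\<in>G ` cball 0 (norm x + 2 * \<bar>R\<bar>). norm t \<le> B"
      unfolding bounded_iff by blast
    then have B: "\<bar>G y\<bar> \<le> B" if "norm y \<le> norm x + 2 * \<bar>R\<bar>" for y
      using that by simp
    show "(\<lambda>i. \<integral>z. F z * G (x - q i z) \<partial>lborel) \<longlonglongrightarrow> (\<integral>z. F z * G (x - z) \<partial>lborel)"
    proof (rule integral_dominated_convergence)
      show "integrable lborel (\<lambda>z. F z * B)"
        using F(1) by simp
      show "AE z in lborel. (\<lambda>i. F z * G (x - q i z)) \<longlonglongrightarrow> F z * G (x - z)"
        using contG q(2)
        by (intro AE_I2 tendsto_intros isCont_tendsto_compose[of _ G])
          (auto simp: continuous_on_eq_continuous_at)
      fix i
      show "AE z in lborel. norm (F z * G (x - q i z)) \<le> F z * B"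
      proof (rule AE_I2)
        fix z
        show "norm (F z * G (x - q i z)) \<le> F z * B"
        proof (cases "R < norm z")
          case False
          have "norm (x - q i z) \<le> norm x + 2 * norm z"
            using norm_triangle_ineq4[of x "q i z"] q(3)[of i z] by linarith
          with False have "norm (x - q i z) \<le> norm x + 2 * \<bar>R\<bar>"
            by linarith
          from B[OF this] F(2) show ?thesis
            by (simp add: abs_mult mult_left_mono)
        qed (simp add: F(3))
      qed
    qed measurable
  qed
qed

text \<open>\<open>V s\<close> is the convolution of \<open>v\<close> with a Gaussian of width \<open>1 / s\<close>. Adding the convolution with
  \<open>Q\<close> turns it into a sum of ridge functions and a positive superposition of translates of \<open>G\<close>.\<close>

lemma null_tame:
  assumes v: "tame v"
  shows "null v"
proof -
  obtain C D r where vConv: "v \<in> Conv" and C: "0 \<le> C" and ge: "\<And>x. C * l1 x - D \<le> v x"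
    and eq: "\<And>x. r \<le> l1 x \<Longrightarrow> v x = C * l1 x - D"
    using v unfolding tame_def by blast
  obtain L where L: "0 \<le> L" "\<And>x y. \<bar>v x - v y\<bar> \<le> L * norm (x - y)"
    using tame_Lipschitz[OF v] by blast
  note [measurable] = Conv_borel_measurable[OF vConv] Conv_borel_measurable[OF Conv_l1]
  \<comment> \<open>Splits \<open>v\<close> into a cone, which is a sum of ridge functions plus a
    constant, and a nonnegative remainder supported in a ball.\<close>
  define f where "f = (\<lambda>x. v x - (C * l1 x - D))"
  have f0: "f z = 0" if "r < norm z" for z
    using eq[of z] norm_le_l1'[of z] that by (simp add: f_def)
  have f_nonneg: "0 \<le> f z" for z
    using ge[of z] by (simp add: f_def)
  have f_cont: "continuous_on S f" for S
    unfolding f_def by (intro continuous_intros Conv_continuous_on vConv Conv_l1)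
  have [measurable]: "f \<in> borel_measurable borel"
    by (intro borel_measurable_continuous_onI f_cont)
  have "bounded (f ` cball 0 r)"
    by (intro compact_imp_bounded compact_continuous_image f_cont) auto
  then obtain B where "\<forall>t\<in>f ` cball 0 r. norm t \<le> B"
    unfolding bounded_iff by blast
  then have "\<bar>f z\<bar> \<le> \<bar>B\<bar>" if "norm z \<le> r" for z
    using that by force
  then have B: "\<bar>f z\<bar> \<le> \<bar>B\<bar>" for z
    using f0[of z] by (cases "norm z \<le> r") simp_all
  have f_int: "integrable lborel f"
  proof -
    have "integrable lborel (\<lambda>z. indicator (cball 0 r) z *\<^sub>R f z)"
      using borel_integrable_compact[OF compact_cball f_cont] .
    also have "(\<lambda>z. indicator (cball 0 r) z *\<^sub>R f z) = f"
      using f0 by (auto simp: fun_eq_iff indicator_def not_le)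
    finally show ?thesis .
  qed
  define \<kappa> where "\<kappa> = 1 / (\<integral>y. gauss y \<partial>(lborel :: 'a measure))"
  have \<kappa>: "0 < \<kappa>"
    using integral_gauss_pos by (simp add: \<kappa>_def)
  define K where "K = (\<lambda>y :: 'a. \<kappa> * gauss y)"
  have K_nonneg: "0 \<le> K y" for y
    using \<kappa> gauss_pos[of y] by (simp add: K_def)
  have [measurable]: "K \<in> borel_measurable borel"
    unfolding K_def by measurable
  have K_int: "integrable lborel (\<lambda>y. h y * K y)"
    if "h \<in> borel_measurable borel" "\<And>y. \<bar>h y\<bar> \<le> a + b * norm y" for h :: "'a \<Rightarrow> real" and a b
    using integrable_mult_right[OF integrable_gauss_bound[OF that], of \<kappa>]
    by (simp add: K_def mult_ac)
  have K1: "(\<integral>y. K y \<partial>lborel) = 1"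
    using integral_gauss_pos[where 'a='a] by (simp add: K_def \<kappa>_def)
  have K_integrable: "integrable lborel K"
    using K_int[of "\<lambda>_. 1" 1 0] by simp
  define V where "V = (\<lambda>s x. \<integral>y. v (x - y /\<^sub>R s) * K y \<partial>lborel)"
  have V_int: "integrable lborel (\<lambda>y. v (x - y /\<^sub>R s) * K y)" if "0 < s" for x s
  proof (rule K_int)
    fix y
    show "\<bar>v (x - y /\<^sub>R s)\<bar> \<le> \<bar>v x\<bar> + (L / s) * norm y"
    proof -
      have "\<bar>v (x - y /\<^sub>R s) - v x\<bar> \<le> (L / s) * norm y"
        using L(2)[of "x - y /\<^sub>R s" x] that by (simp add: divide_inverse mult_ac)
      then show ?thesis by linarith
    qed
  qed measurable
  have "null (V s)" if s: "0 < s" for s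
  proof -
    \<comment> \<open>The smoothed cone splits by coordinates: \<open>\<psi> b\<close> is the convex
      profile of the ridge function in direction \<open>b\<close>.\<close>
    define \<psi> where "\<psi> = (\<lambda>b t. \<integral>y. C * (\<bar>t - (y \<bullet> b) / s\<bar> * K y) \<partial>lborel)"
    have \<psi>_int: "integrable lborel (\<lambda>y. C * (\<bar>t - (y \<bullet> b) / s\<bar> * K y))" for b t
    proof (intro integrable_mult_right K_int)
      fix y
      have "\<bar>t - (y \<bullet> b) / s\<bar> \<le> \<bar>t\<bar> + \<bar>y \<bullet> b\<bar> / s"
        using s by (simp add: abs_divide order_trans[OF abs_triangle_ineq4])
      also have "\<bar>y \<bullet> b\<bar> / s \<le> norm y * norm b / s"
        using s Cauchy_Schwarz_ineq2[of y b] by (intro divide_right_mono) auto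
      finally show "\<bar>\<bar>t - (y \<bullet> b) / s\<bar>\<bar> \<le> \<bar>t\<bar> + (norm b / s) * norm y"
        by (simp add: mult_ac)
    qed measurable
    have \<psi>_Conv: "\<psi> b \<in> Conv" for b
      unfolding \<psi>_def
    proof (rule Conv_integral[OF _ \<psi>_int])
      fix y
      have "(\<lambda>t :: real. max (1 \<bullet> t + - ((y \<bullet> b) / s)) ((- 1) \<bullet> t + (y \<bullet> b) / s)) \<in> Conv"
        by (intro Conv_max Conv_add Conv_inner Conv_const)
      also have "(\<lambda>t :: real. max (1 \<bullet> t + - ((y \<bullet> b) / s)) ((- 1) \<bullet> t + (y \<bullet> b) / s))
          = (\<lambda>t. \<bar>t - (y \<bullet> b) / s\<bar>)"
        by (auto simp: fun_eq_iff max_def)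
      finally have "(\<lambda>t. (C * K y) * \<bar>t - (y \<bullet> b) / s\<bar>) \<in> Conv"
        using C K_nonneg by (intro Conv_cmul mult_nonneg_nonneg)
      then show "(\<lambda>t. C * (\<bar>t - (y \<bullet> b) / s\<bar> * K y)) \<in> Conv"
        by (simp add: mult_ac)
    qed
    \<comment> \<open>The factor \<open>s ^ DIM('a)\<close> is the Jacobian of the substitution
      \<open>y = s *\<^sub>R (x - z)\<close>, and \<open>\<kappa>\<close> normalises the
      Gaussian.\<close>
    define F where "F = (\<lambda>z. \<kappa> * s ^ DIM('a) * f z)"
    have F: "integrable lborel F" "\<And>z. 0 \<le> F z" "\<And>z. r < norm z \<Longrightarrow> F z = 0"
      using f_int f_nonneg f0 \<kappa> s by (auto simp: F_def)
    \<comment> \<open>The Gaussian \<open>G - Q\<close> is not convex by itself, but both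
      \<open>G\<close> and \<open>Q\<close> are null together with their translates and nonnegative
      multiples.\<close>
    define G where "G = (\<lambda>y :: 'a. gauss (s *\<^sub>R y) + (norm (s *\<^sub>R y))\<^sup>2 / 2)"
    define Q where "Q = (\<lambda>y :: 'a. (norm (s *\<^sub>R y))\<^sup>2 / 2)"
    have G_cont: "continuous_on UNIV G" and Q_cont: "continuous_on UNIV Q"
      unfolding G_def Q_def
      by (intro continuous_intros continuous_on_compose2[OF continuous_on_gauss[of UNIV]] | simp)+
    have G_null: "null (\<lambda>x. \<integral>z. F z * G (x - z) \<partial>lborel)"
      by (rule null_integral[OF _ G_cont F]) (unfold G_def, rule null_gauss)
    have Q_null: "null (\<lambda>x. \<integral>z. F z * Q (x - z) \<partial>lborel)"
    proof (rule null_integral[OF _ Q_cont F])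
      fix c z assume "0 \<le> (c :: real)"
      then have "null (\<lambda>x. (c * s\<^sup>2 / 2) * (norm (x - z))\<^sup>2)"
        by (intro null_norm_square) simp
      then show "null (\<lambda>x. c * Q (x - z))"
        by (simp add: Q_def power_mult_distrib mult_ac)
    qed
    have FG_int: "integrable lborel (\<lambda>z. F z * H (x - z))" if H: "continuous_on UNIV H" for H x
    proof -
      have "integrable lborel (\<lambda>z. indicator (cball 0 r) z *\<^sub>R (F z * H (x - z)))"
        unfolding F_def
        by (intro borel_integrable_compact compact_cball continuous_intros f_cont
            continuous_on_compose2[OF H]) auto
      also have "(\<lambda>z. indicator (cball 0 r) z *\<^sub>R (F z * H (x - z))) = (\<lambda>z. F z * H (x - z))"
        using F(3) by (auto simp: fun_eq_iff indicator_def not_le)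
      finally show ?thesis .
    qed
    \<comment> \<open>The cone contributes the ridge functions and the constant. The smoothed
      remainder is the integral of \<open>F\<close> against \<open>G - Q\<close>, so adding the
      \<open>Q\<close>-part leaves only null terms on the right.\<close>
    have VQ: "V s x + (\<integral>z. F z * Q (x - z) \<partial>lborel)
        = (\<Sum>b\<in>Basis. \<psi> b (b \<bullet> x)) + (0 \<bullet> x + - D) + (\<integral>z. F z * G (x - z) \<partial>lborel)" for x
    proof -
      have fK_int: "integrable lborel (\<lambda>y. f (x - y /\<^sub>R s) * K y)"
        using B by (intro K_int[of _ "\<bar>B\<bar>" 0]) auto
      have "v (x - y /\<^sub>R s) * K y = (\<Sum>b\<in>Basis. C * (\<bar>b \<bullet> x - (y \<bullet> b) / s\<bar> * K y)) - D * K y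
          + f (x - y /\<^sub>R s) * K y" for y
      proof -
        have "(x - y /\<^sub>R s) \<bullet> b = b \<bullet> x - (y \<bullet> b) / s" for b
          by (simp add: inner_diff_left inner_commute[of x] divide_inverse mult.commute)
        then have "(\<Sum>b\<in>Basis. C * (\<bar>b \<bullet> x - (y \<bullet> b) / s\<bar> * K y)) = C * l1 (x - y /\<^sub>R s) * K y"
          by (simp add: l1_def sum_distrib_left sum_distrib_right mult.assoc)
        then show ?thesis
          by (simp add: f_def left_diff_distrib)
      qed
      then have "V s x = (\<integral>y. (\<Sum>b\<in>Basis. C * (\<bar>b \<bullet> x - (y \<bullet> b) / s\<bar> * K y)) - D * K y
          + f (x - y /\<^sub>R s) * K y \<partial>lborel)"
        by (simp add: V_def)
      also have "\<dots> = (\<Sum>b\<in>Basis. \<psi> b (b \<bullet> x)) - D + (\<integral>y. f (x - y /\<^sub>R s) * K y \<partial>lborel)"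
        using \<psi>_int fK_int K_integrable K1 unfolding \<psi>_def
        by (simp add: Bochner_Integration.integral_add Bochner_Integration.integral_diff
            Bochner_Integration.integral_sum Bochner_Integration.integrable_sum del: integral_mult_right_zero)
      \<comment> \<open>Substitute \<open>y = s *\<^sub>R x - s *\<^sub>R z\<close>, which moves the
        dependence on \<open>x\<close> from \<open>f\<close> to the kernel.\<close>
      also have "(\<integral>y. f (x - y /\<^sub>R s) * K y \<partial>lborel)
          = s ^ DIM('a) * (\<integral>z. f z * K (s *\<^sub>R (x - z)) \<partial>lborel)"
        using lborel_integral_affine[of "\<lambda>y. f (x - y /\<^sub>R s) * K y" "- s" "s *\<^sub>R x"] s
        by (simp add: algebra_simps)
      also have "\<dots> = (\<integral>z. F z * G (x - z) - F z * Q (x - z) \<partial>lborel)"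
        unfolding F_def G_def Q_def K_def
        by (subst integral_mult_right_zero[symmetric]) (simp add: algebra_simps)
      also have "\<dots> = (\<integral>z. F z * G (x - z) \<partial>lborel) - (\<integral>z. F z * Q (x - z) \<partial>lborel)"
        by (intro Bochner_Integration.integral_diff FG_int G_cont Q_cont)
      finally show ?thesis by simp
    qed
    show "null (V s)"
    proof (rule null_cancel[OF Q_null])
      show "V s \<in> Conv"
        unfolding V_def
      proof (rule Conv_integral[OF _ V_int[OF s]])
        fix y
        have "(\<lambda>x. v (x + - (y /\<^sub>R s))) \<in> Conv"
          by (rule Conv_comp_affine[OF vConv linear_id[unfolded id_def]])
        from Conv_cmul[OF K_nonneg this, of y] show "(\<lambda>x. v (x - y /\<^sub>R s) * K y) \<in> Conv"
          by (simp add: mult.commute)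
      qed
      show "null (\<lambda>x. V s x + (\<integral>z. F z * Q (x - z) \<partial>lborel))"
        unfolding VQ by (intro null_add null_sum null_ridge \<psi>_Conv null_affine G_null finite_Basis)
    qed
  qed
  moreover have "(\<lambda>k. V (real (Suc k)) x) \<longlonglongrightarrow> v x" for x
  proof (rule Lim_null_comparison[THEN LIM_zero_cancel])
    \<comment> \<open>By the Lipschitz bound, smoothing at width \<open>1 / s\<close> costs at most
      \<open>L / s\<close> times the first absolute moment of \<open>K\<close>.\<close>
    define M where "M = L * (\<integral>y. norm y * K y \<partial>lborel)"
    show "(\<lambda>k. M / real (Suc k)) \<longlonglongrightarrow> 0"
      by (rule LIMSEQ_Suc) (rule lim_const_over_n)
    show "eventually (\<lambda>k. norm (V (real (Suc k)) x - v x) \<le> M / real (Suc k)) sequentially"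
    proof (intro always_eventually allI)
      fix k
      define s where "s = real (Suc k)"
      have s: "0 < s" by (simp add: s_def)
      have vK: "integrable lborel (\<lambda>y. v x * K y)"
        using K_integrable by simp
      have "V s x - v x = (\<integral>y. v (x - y /\<^sub>R s) * K y - v x * K y \<partial>lborel)"
        unfolding V_def using V_int[OF s, of x] vK K1 by simp
      also have "norm \<dots> \<le> (\<integral>y. norm (v (x - y /\<^sub>R s) * K y - v x * K y) \<partial>lborel)"
        by (rule integral_norm_bound)
      also have "\<dots> \<le> (\<integral>y. (L / s) * (norm y * K y) \<partial>lborel)"
      proof (rule integral_mono)
        show "integrable lborel (\<lambda>y. norm (v (x - y /\<^sub>R s) * K y - v x * K y))"
          using V_int[OF s, of x] vK by (intro integrable_norm Bochner_Integration.integrable_diff)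
        show "integrable lborel (\<lambda>y. (L / s) * (norm y * K y))"
          by (intro integrable_mult_right K_int[of _ 0 1]) auto
        fix y
        have "\<bar>v (x - y /\<^sub>R s) - v x\<bar> * K y \<le> (L * norm (y /\<^sub>R s)) * K y"
          using L(2)[of "x - y /\<^sub>R s" x] K_nonneg by (intro mult_right_mono) auto
        moreover have "norm (v (x - y /\<^sub>R s) * K y - v x * K y) = \<bar>v (x - y /\<^sub>R s) - v x\<bar> * K y"
          using K_nonneg[of y] by (simp only: left_diff_distrib[symmetric] real_norm_def abs_mult abs_of_nonneg)
        ultimately show "norm (v (x - y /\<^sub>R s) * K y - v x * K y) \<le> (L / s) * (norm y * K y)"
          using s by (simp add: divide_inverse mult_ac)
      qed
      also have "\<dots> = M / s"
        by (simp add: M_def)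
      finally show "norm (V (real (Suc k)) x - v x) \<le> M / real (Suc k)"
        by (simp add: s_def)
    qed
  qed
  ultimately show ?thesis
    by (rule null_limit[of "\<lambda>k. V (real (Suc k))"]) simp
qed

lemma null_if_Conv:
  assumes "v \<in> Conv"
  shows "null v"
proof -
  obtain vs where "\<And>k::nat. tame (vs k)" "\<And>x. (\<lambda>k. vs k x) \<longlonglongrightarrow> v x"
    using tame_approximation[OF assms] by blast
  then show ?thesis
    by (intro null_limit[OF null_tame])
qed

end

lemma add_Conv_if_add_hinge:
  assumes "invariant_valuation Y"
    and "\<And>u a \<alpha>. u \<in> Conv \<Longrightarrow> Y (\<lambda>x. u x + hinge a \<alpha> x) = Y u"
    and "u \<in> Conv" "v \<in> Conv"
  shows "Y (\<lambda>x. u x + v x) = Y u"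
proof -
  interpret hinge_invariant Y
    using assms by unfold_locales
  from null_if_Conv[OF assms(4)] assms(3) show ?thesis
    by (simp add: null_def)
qed

section \<open>Polynomial dependence on dilations\<close>

text \<open>Hinges are replaced by convex functions one at a time. By induction for
  \<open>diff_by (hinge a \<alpha>) Z\<close>, the functional \<open>iter_diff ws' Z\<close> is
  unchanged by adding a hinge; by \<open>add_Conv_if_add_hinge\<close> it is then unchanged by
  adding \<open>w\<close>.\<close>

lemma iter_diff_Conv_eq_0:
  fixes Z :: "('a::euclidean_space \<Rightarrow> real) \<Rightarrow> real"
  assumes "invariant_valuation Z"
    and "\<And>ws u. length ws = m \<Longrightarrow> set ws \<subseteq> range (case_prod hinge) \<Longrightarrow> u \<in> Conv \<Longrightarrow> iter_diff ws Z u = 0"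
    and "length ws = m" "set ws \<subseteq> Conv" "u \<in> Conv"
  shows "iter_diff ws Z u = 0"
  using assms
proof (induction m arbitrary: Z ws u)
  case 0
  then show ?case by simp
next
  case (Suc m)
  note Z = Suc.prems(1) and hinges = Suc.prems(2)
  obtain w ws' where ws: "ws = w # ws'"
    using Suc.prems(3) by (cases ws) auto
  have w: "w \<in> Conv" and ws': "set ws' \<subseteq> Conv" "length ws' = m"
    using Suc.prems ws by auto
  have "iter_diff ws' Z (\<lambda>x. u x + hinge a \<alpha> x) = iter_diff ws' Z u" if u: "u \<in> Conv" for u a \<alpha>
  proof -
    have "iter_diff ws' (diff_by (hinge a \<alpha>) Z) u = 0"
    proof (rule Suc.IH[OF invariant_valuation_diff_by[OF Z Conv_hinge] _ ws'(2,1) u])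
      fix vs :: "('a \<Rightarrow> real) list" and v :: "'a \<Rightarrow> real"
      assume "length vs = m" "set vs \<subseteq> range (case_prod hinge)" "v \<in> Conv"
      then show "iter_diff vs (diff_by (hinge a \<alpha>) Z) v = 0"
        using hinges[of "hinge a \<alpha> # vs" v] by auto
    qed
    then show ?thesis
      by (simp add: iter_diff_diff_by) (simp add: diff_by_def)
  qed
  from add_Conv_if_add_hinge[OF invariant_valuation_iter_diff[OF Z ws'(1)] this Suc.prems(5) w]
  have "diff_by w (iter_diff ws' Z) u = 0"
    by (simp add: diff_by_def)
  then show ?case
    by (simp add: ws iter_diff_diff_by)
qed

section \<open>Polynomials from vanishing finite differences\<close>

lemma binomial_eq_poly:
  obtains p :: "real poly" where "degree p \<le> i" "\<And>k. of_nat (k choose i) = poly p (of_nat k)"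
proof
  let ?p = "smult (1 / fact i) (\<Prod>j<i. [:- of_nat j, 1:]) :: real poly"
  have "degree (\<Prod>j<i. [:- of_nat j, 1 :: real:]) \<le> (\<Sum>j<i. degree [:- of_nat j, 1 :: real:])"
    using degree_prod_sum_le[of "{..<i}" "\<lambda>j. [:- of_nat j, 1 :: real:]"] by (simp add: o_def)
  then show "degree ?p \<le> i"
    by (simp add: degree_smult_eq)
  show "of_nat (k choose i) = poly ?p (of_nat k)" for k
    by (simp add: binomial_gbinomial gbinomial_prod_rev poly_prod atLeast0LessThan)
qed

text \<open>Newton's forward difference formula, with \<open>b m k\<close> as the
  \<open>m\<close>-th difference at \<open>k\<close>. Differences of order above \<open>n\<close>
  vanish, so at most \<open>n + 1\<close> binomial polynomials remain.\<close>

lemma finite_differences_eq_0_imp_poly: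
  fixes b :: "nat \<Rightarrow> nat \<Rightarrow> real"
  assumes step: "\<And>m k. b (Suc m) k = b m (Suc k) - b m k" and zero: "\<And>k. b (Suc n) k = 0"
  obtains p :: "real poly" where "degree p \<le> n" "\<And>k. b 0 k = poly p (of_nat k)"
proof -
  have newton: "b m k = (\<Sum>i\<le>k. of_nat (k choose i) * b (m + i) 0)" for m k
  proof (induction k arbitrary: m)
    case (Suc k)
    have "b m (Suc k) = b m k + b (Suc m) k"
      using step[of m k] by simp
    also have "\<dots> = (\<Sum>i\<le>k. of_nat (k choose i) * b (m + i) 0) + (\<Sum>i\<le>k. of_nat (k choose i) * b (m + Suc i) 0)"
      using Suc[of m] Suc[of "Suc m"] by simp
    also have "(\<Sum>i\<le>k. of_nat (k choose i) * b (m + i) 0) = (\<Sum>i\<le>Suc k. of_nat (k choose i) * b (m + i) 0)"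
      by simp
    also have "\<dots> = b m 0 + (\<Sum>i\<le>k. of_nat (k choose Suc i) * b (m + Suc i) 0)"
      by (subst sum.atMost_Suc_shift) simp
    finally show ?case
      by (subst sum.atMost_Suc_shift) (simp add: sum.distrib algebra_simps)
  qed simp
  have zeros: "b (Suc n + i) k = 0" for i k
    by (induction i arbitrary: k) (use zero step in simp_all)
  have "\<exists>p :: real poly. degree p \<le> i \<and> (\<forall>k. of_nat (k choose i) = poly p (of_nat k))" for i
    using binomial_eq_poly by metis
  then obtain q :: "nat \<Rightarrow> real poly" where
    q: "\<And>i. degree (q i) \<le> i" "\<And>i k. of_nat (k choose i) = poly (q i) (of_nat k)"
    by metis
  show thesis
  proof (rule that[of "\<Sum>i\<le>n. smult (b i 0) (q i)"])
    show "degree (\<Sum>i\<le>n. smult (b i 0) (q i)) \<le> n"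
      using q(1) by (intro degree_sum_le) (auto intro: order_trans degree_smult_le)
    fix k
    have "b 0 k = (\<Sum>i\<le>k. of_nat (k choose i) * b i 0)"
      using newton[of 0 k] by simp
    \<comment> \<open>Both truncations are compared with this common range: terms with
      \<open>i > k\<close> have zero binomial coefficient, terms with \<open>i > n\<close> have zero
      difference.\<close>
    also have "\<dots> = (\<Sum>i\<le>max k n. of_nat (k choose i) * b i 0)"
      by (intro sum.mono_neutral_left) (auto simp: binomial_eq_0)
    also have "\<dots> = (\<Sum>i\<le>n. of_nat (k choose i) * b i 0)"
    proof (intro sum.mono_neutral_right ballI)
      fix i assume "i \<in> {..max k n} - {..n}"
      then obtain j where "i = Suc n + j"
        using less_iff_Suc_add[of n i] by auto
      then show "of_nat (k choose i) * b i 0 = 0"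
        using zeros[of j 0] by simp
    qed auto
    finally show "b 0 k = poly (\<Sum>i\<le>n. smult (b i 0) (q i)) (of_nat k)"
      by (simp add: poly_sum q(2) mult.commute)
  qed
qed

lemma poly_eq_if_eq_naturals:
  fixes p q :: "real poly"
  assumes "\<And>j::nat. poly p (of_nat j) = poly q (of_nat j)"
  shows "p = q"
proof (rule ccontr)
  assume "p \<noteq> q"
  then have "finite {x. poly (p - q) x = 0}"
    by (intro poly_roots_finite) simp
  moreover have "range (of_nat :: nat \<Rightarrow> real) \<subseteq> {x. poly (p - q) x = 0}"
    using assms by auto
  ultimately have "finite (range (of_nat :: nat \<Rightarrow> real))"
    by (rule rev_finite_subset)
  then show False
    using range_inj_infinite[of "of_nat :: nat \<Rightarrow> real"] by (simp add: inj_of_nat)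
qed

text \<open>Vanishing differences along \<open>s * v\<close> give a polynomial on each arithmetic
  progression of multiples of \<open>s\<close>. The polynomials for the steps
  \<open>1 / Suc N\<close> all come from one by rescaling, which settles rational \<open>t\<close>;
  continuity settles the rest.\<close>

lemma invariant_valuation_dilation_poly:
  fixes Z :: "('a::euclidean_space \<Rightarrow> real) \<Rightarrow> real"
  assumes Z: "invariant_valuation Z" and v: "v \<in> Conv"
  obtains p where "degree p \<le> DIM('a)" "\<And>t. 0 \<le> t \<Longrightarrow> Z (\<lambda>x. t * v x) = poly p t"
proof -
  have scaled: "(\<lambda>x. t * v x) \<in> Conv" if "0 \<le> t" for t
    using Conv_cmul[OF that v] .
  have arithmetic: "\<exists>p. degree p \<le> DIM('a) \<and> (\<forall>k::nat. Z (\<lambda>x. (of_nat k * s) * v x) = poly p (of_nat k))"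
    if s: "0 \<le> s" for s
  proof -
    \<comment> \<open>The \<open>m\<close>-th difference with increment \<open>s * v\<close>, taken
      at the \<open>k\<close>-th point of the progression.\<close>
    define b where "b = (\<lambda>m k. iter_diff (replicate m (\<lambda>x. s * v x)) Z (\<lambda>x. (of_nat k * s) * v x))"
    have step: "b (Suc m) k = b m (Suc k) - b m k" for m k
      by (simp add: b_def iter_diff_diff_by) (simp add: diff_by_def algebra_simps)
    have zero: "b (Suc DIM('a)) k = 0" for k
      unfolding b_def
    proof (rule iter_diff_Conv_eq_0[OF Z iter_diff_hinges_eq_0[OF Z]])
      show "set (replicate (Suc DIM('a)) (\<lambda>x. s * v x)) \<subseteq> Conv"
        using scaled[OF s] by auto
      show "(\<lambda>x. (of_nat k * s) * v x) \<in> Conv"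
        using s by (intro scaled) simp
    qed auto
    obtain p where "degree p \<le> DIM('a)" "\<And>k. b 0 k = poly p (of_nat k)"
      using finite_differences_eq_0_imp_poly[of b, OF step zero] by metis
    then show ?thesis
      by (auto simp: b_def)
  qed
  have "\<exists>p. degree p \<le> DIM('a) \<and>
      (\<forall>k::nat. Z (\<lambda>x. (of_nat k * (1 / of_nat (Suc N))) * v x) = poly p (of_nat k))" for N
    by (rule arithmetic) simp
  then obtain P where P: "\<And>N. degree (P N) \<le> DIM('a)"
    "\<And>N k. Z (\<lambda>x. (of_nat k * (1 / of_nat (Suc N))) * v x) = poly (P N) (of_nat k)"
    by metis
  have rat: "Z (\<lambda>x. (of_nat k / of_nat (Suc N)) * v x) = poly (P 0) (of_nat k / of_nat (Suc N))" for k N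
  proof -
    \<comment> \<open>The progression with step 1 is the part of the finer one at multiples of
      \<open>Suc N\<close>, and infinitely many common values determine a polynomial.\<close>
    have "pcompose (P N) [:0, of_nat (Suc N):] = P 0"
    proof (rule poly_eq_if_eq_naturals)
      fix j :: nat
      have "poly (P N) (of_nat (j * Suc N)) = poly (P 0) (of_nat j)"
      proof -
        have "of_nat (j * Suc N) * (1 / of_nat (Suc N)) = (of_nat j * (1 / of_nat (Suc 0)) :: real)"
          by (simp add: field_simps)
        then show ?thesis
          using P(2)[of "j * Suc N" N] P(2)[of j 0] by metis
      qed
      then show "poly (pcompose (P N) [:0, of_nat (Suc N):]) (of_nat j) = poly (P 0) (of_nat j)"
        by (simp add: poly_pcompose algebra_simps)
    qed
    then have "poly (P 0) (of_nat k / of_nat (Suc N))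
        = poly (pcompose (P N) [:0, of_nat (Suc N):]) (of_nat k / of_nat (Suc N))"
      by simp
    also have "\<dots> = poly (P N) (of_nat k)"
      by (simp add: poly_pcompose del: of_nat_Suc)
    finally show ?thesis
      using P(2)[of k N] by simp
  qed
  have "Z (\<lambda>x. t * v x) = poly (P 0) t" if t: "0 \<le> t" for t
  proof -
    define r where "r = (\<lambda>N. of_nat (nat \<lfloor>t * of_nat (Suc N)\<rfloor>) / of_nat (Suc N) :: real)"
    have r_nonneg: "0 \<le> r N" for N
      by (simp add: r_def)
    have bound: "norm (r N - t) \<le> 1 / of_nat (Suc N)" for N
    proof -
      have "real (nat \<lfloor>t * of_nat (Suc N)\<rfloor>) = of_int \<lfloor>t * of_nat (Suc N)\<rfloor>"
        using t by simp
      then have "\<bar>real (nat \<lfloor>t * of_nat (Suc N)\<rfloor>) - t * of_nat (Suc N)\<bar> \<le> 1"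
        by linarith
      moreover have "r N - t = (of_nat (nat \<lfloor>t * of_nat (Suc N)\<rfloor>) - t * of_nat (Suc N)) / of_nat (Suc N)"
        by (simp add: r_def diff_divide_distrib del: of_nat_Suc)
      ultimately show ?thesis
        by (simp add: abs_divide divide_right_mono del: of_nat_Suc)
    qed
    have lim0: "(\<lambda>N. 1 / of_nat (Suc N)) \<longlonglongrightarrow> (0 :: real)"
      by (rule LIMSEQ_Suc) (rule lim_const_over_n)
    have r_lim: "r \<longlonglongrightarrow> t"
    proof (rule LIM_zero_cancel)
      show "(\<lambda>N. r N - t) \<longlonglongrightarrow> 0"
        by (rule Lim_null_comparison[OF always_eventually lim0]) (use bound in blast)
    qed
    have "(\<lambda>N. Z (\<lambda>x. r N * v x)) \<longlonglongrightarrow> Z (\<lambda>x. t * v x)"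
      by (rule epi_continuousD[OF invariant_valuation_epi_continuous[OF Z]])
        (intro scaled t r_nonneg tendsto_intros r_lim)+
    moreover have "(\<lambda>N. Z (\<lambda>x. r N * v x)) = (\<lambda>N. poly (P 0) (r N))"
      unfolding r_def rat ..
    moreover have "(\<lambda>N. poly (P 0) (r N)) \<longlonglongrightarrow> poly (P 0) t"
      by (intro tendsto_intros r_lim)
    ultimately show ?thesis
      using LIMSEQ_unique by metis
  qed
  with P(1) show thesis
    using that by blast
qed

section \<open>Lagrange interpolation\<close>

text \<open>Interpolation at the nodes \<open>0, ..., n\<close>. Since \<open>l\<close> does not
  depend on \<open>p\<close>, each coefficient of \<open>p\<close> is a fixed linear combination of
  the values at the nodes.\<close>

lemma Lagrange_basis:
  obtains l :: "nat \<Rightarrow> real poly" where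
    "\<And>p. degree p \<le> n \<Longrightarrow> p = (\<Sum>j\<le>n. smult (poly p (of_nat j)) (l j))"
proof -
  define l where "l = (\<lambda>j. \<Prod>i\<in>{..n} - {j}. smult (1 / (of_nat j - of_nat i)) [:- of_nat i, 1 :: real:])"
  have deg: "degree (l j) \<le> n" if "j \<le> n" for j
  proof -
    have "degree (l j) \<le> (\<Sum>i\<in>{..n} - {j}. degree (smult (1 / (of_nat j - of_nat i)) [:- of_nat i, 1 :: real:]))"
      unfolding l_def by (rule order_trans[OF degree_prod_sum_le]) (simp_all add: o_def)
    also have "\<dots> \<le> (\<Sum>i\<in>{..n} - {j}. 1)"
      by (intro sum_mono) (auto simp: degree_smult_eq)
    also have "\<dots> = n"
      using that by simp
    finally show ?thesis .
  qed
  have l_node: "poly (l j) (of_nat k) = (if j = k then 1 else 0)" if "j \<le> n" "k \<le> n" for j k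
  proof (cases "j = k")
    case True
    then show ?thesis
      by (auto simp: l_def poly_prod diff_divide_distrib[symmetric] intro!: prod.neutral)
  next
    case False
    with that show ?thesis
      unfolding l_def poly_prod by (subst prod_zero) (auto intro!: bexI[of _ k])
  qed
  have "p = (\<Sum>j\<le>n. smult (poly p (of_nat j)) (l j))" if p: "degree p \<le> n" for p
  proof (rule poly_eqI_degree)
    fix x :: real assume "x \<in> of_nat ` {..n}"
    then obtain k where k: "k \<le> n" "x = of_nat k" by auto
    have "poly (\<Sum>j\<le>n. smult (poly p (of_nat j)) (l j)) x = (\<Sum>j\<le>n. if j = k then poly p (of_nat j) else 0)"
      unfolding poly_sum k(2) using l_node k(1) by (intro sum.cong) auto
    then show "poly p x = poly (\<Sum>j\<le>n. smult (poly p (of_nat j)) (l j)) x"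
      using k by simp
  next
    have card: "card (of_nat ` {..n} :: real set) = Suc n"
      by (simp add: card_image inj_on_def)
    show "degree p < card (of_nat ` {..n} :: real set)"
      using p by (simp add: card)
    have "degree (\<Sum>j\<le>n. smult (poly p (of_nat j)) (l j)) \<le> n"
      using deg by (intro degree_sum_le) (auto intro: order_trans degree_smult_le)
    then show "degree (\<Sum>j\<le>n. smult (poly p (of_nat j)) (l j)) < card (of_nat ` {..n} :: real set)"
      by (simp add: card)
  qed
  then show thesis
    using that by blast
qed

section \<open>Dilations and linear combinations of invariant valuations\<close>

lemma invariant_valuation_dilate:
  fixes Z :: "('a::euclidean_space \<Rightarrow> real) \<Rightarrow> real"
  assumes Z: "invariant_valuation Z" and c: "0 \<le> c"
  shows "invariant_valuation (\<lambda>v. Z (\<lambda>x. c * v x))"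
  unfolding invariant_valuation_def
proof (intro conjI)
  have Zs: "epi_continuous Z" "dually_epi_translation_invariant Z" "valuation_on Conv Z"
    using Z by (auto simp: invariant_valuation_def)
  note Conv_c = Conv_cmul[OF c]
  show "epi_continuous (\<lambda>v. Z (\<lambda>x. c * v x))"
    unfolding epi_continuous_def
  proof (intro allI ballI impI)
    fix vs and v :: "'a \<Rightarrow> real"
    assume "v \<in> Conv" "\<forall>k. vs k \<in> Conv" "epi_converges vs v"
    with Zs(1)[unfolded epi_continuous_def, rule_format, of "\<lambda>x. c * v x" "\<lambda>k x. c * vs k x"]
    show "(\<lambda>k. Z (\<lambda>x. c * vs k x)) \<longlonglongrightarrow> Z (\<lambda>x. c * v x)"
      using Conv_c epi_converges_cmul[OF _ c] by blast
  qed
  show "dually_epi_translation_invariant (\<lambda>v. Z (\<lambda>x. c * v x))"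
    unfolding dually_epi_translation_invariant_def dually_translation_invariant_def
      vertically_translation_invariant_def
  proof (intro conjI ballI allI impI)
    fix v l :: "'a \<Rightarrow> real" assume "v \<in> Conv" "linear l"
    then have "linear (\<lambda>x. c * l x)" "(\<lambda>x. c * v x) \<in> Conv"
      using linear_compose_scale_right[of l c] Conv_c by simp_all
    then show "Z (\<lambda>x. c * (v x + l x)) = Z (\<lambda>x. c * v x)"
      using Zs(2) by (simp add: dually_epi_translation_invariant_def dually_translation_invariant_def
          distrib_left)
  next
    fix v :: "'a \<Rightarrow> real" and \<alpha> :: real assume "v \<in> Conv"
    from Conv_c[OF this] show "Z (\<lambda>x. c * (v x + \<alpha>)) = Z (\<lambda>x. c * v x)"
      using Zs(2) by (simp add: dually_epi_translation_invariant_def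
          vertically_translation_invariant_def distrib_left)
  qed
  show "valuation_on Conv (\<lambda>v. Z (\<lambda>x. c * v x))"
    unfolding valuation_on_def
  proof (intro ballI impI)
    fix u v :: "'a \<Rightarrow> real"
    assume "u \<in> Conv" "v \<in> Conv" "(\<lambda>x. max (u x) (v x)) \<in> Conv" "(\<lambda>x. min (u x) (v x)) \<in> Conv"
    then show "Z (\<lambda>x. c * max (u x) (v x)) + Z (\<lambda>x. c * min (u x) (v x))
        = Z (\<lambda>x. c * u x) + Z (\<lambda>x. c * v x)"
      using c by (intro invariant_valuation_max_min[OF Z] Conv_c)
        (simp_all add: max_mult_distrib_left min_mult_distrib_left)
  qed
qed

lemma invariant_valuation_linear_combination:
  fixes Z :: "'i \<Rightarrow> ('a::euclidean_space \<Rightarrow> real) \<Rightarrow> real"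
  assumes "\<And>i. i \<in> I \<Longrightarrow> invariant_valuation (Z i)"
  shows "invariant_valuation (\<lambda>v. \<Sum>i\<in>I. a i * Z i v)"
  unfolding invariant_valuation_def
proof (intro conjI)
  show "epi_continuous (\<lambda>v. \<Sum>i\<in>I. a i * Z i v)"
    using assms unfolding invariant_valuation_def epi_continuous_def
    by (intro allI ballI impI tendsto_sum tendsto_mult_left) blast
  show "dually_epi_translation_invariant (\<lambda>v. \<Sum>i\<in>I. a i * Z i v)"
    using assms unfolding invariant_valuation_def dually_epi_translation_invariant_def
      dually_translation_invariant_def vertically_translation_invariant_def by simp
  show "valuation_on Conv (\<lambda>v. \<Sum>i\<in>I. a i * Z i v)"
    unfolding valuation_on_def
  proof (intro ballI impI)
    fix u v :: "'a \<Rightarrow> real"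
    assume uv: "u \<in> Conv" "v \<in> Conv" "(\<lambda>x. max (u x) (v x)) \<in> Conv" "(\<lambda>x. min (u x) (v x)) \<in> Conv"
    have "a i * Z i (\<lambda>x. max (u x) (v x)) + a i * Z i (\<lambda>x. min (u x) (v x)) = a i * Z i u + a i * Z i v"
      if "i \<in> I" for i
      using invariant_valuation_max_min[OF assms[OF that] uv] by (simp add: distrib_left[symmetric])
    then show "(\<Sum>i\<in>I. a i * Z i (\<lambda>x. max (u x) (v x))) + (\<Sum>i\<in>I. a i * Z i (\<lambda>x. min (u x) (v x)))
        = (\<Sum>i\<in>I. a i * Z i u) + (\<Sum>i\<in>I. a i * Z i v)"
      by (simp add: sum.distrib[symmetric])
  qed
qed

section \<open>Homogeneous decomposition\<close>

theorem theorem4: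
  fixes Z :: "(real ^ 'n \<Rightarrow> real) \<Rightarrow> real"
  assumes "epi_continuous Z"
    and "dually_epi_translation_invariant Z"
    and "valuation_on Conv Z"
  shows "\<exists>Zs :: nat \<Rightarrow> (real ^ 'n \<Rightarrow> real) \<Rightarrow> real.
           (\<forall>i\<in>{0..CARD('n)}. epi_continuous (Zs i) \<and>
              dually_epi_translation_invariant (Zs i) \<and>
              valuation_on Conv (Zs i) \<and>
              homogeneous_of_degree i (Zs i)) \<and>
           (\<forall>v\<in>Conv. Z v = (\<Sum>i = 0..CARD('n). Zs i v))"
proof -
  define n where "n = CARD('n)"
  have Z: "invariant_valuation Z"
    using assms by (simp add: invariant_valuation_def)
  obtain l :: "nat \<Rightarrow> real poly" where
    l: "\<And>p. degree p \<le> n \<Longrightarrow> p = (\<Sum>j\<le>n. smult (poly p (of_nat j)) (l j))"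
    using Lagrange_basis[of n] by metis
  \<comment> \<open>For convex \<open>v\<close>, this is the coefficient of \<open>t ^ i\<close> in
    the polynomial \<open>Z (\<lambda>x. t * v x)\<close>, recovered from
    \<open>t = 0, ..., n\<close>. Written with fixed weights, it is visibly an invariant valuation
    in \<open>v\<close>.\<close>
  define Zs where "Zs = (\<lambda>i v. \<Sum>j\<le>n. coeff (l j) i * Z (\<lambda>x. of_nat j * v x))"
  have Zs: "invariant_valuation (Zs i)" for i
    unfolding Zs_def by (intro invariant_valuation_linear_combination invariant_valuation_dilate Z) simp
  have dilation: "\<exists>p. degree p \<le> n \<and> (\<forall>t\<ge>0. Z (\<lambda>x. t * v x) = poly p t) \<and> (\<forall>i. coeff p i = Zs i v)"
    if v: "v \<in> Conv" for v
  proof -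
    obtain p where p: "degree p \<le> n" "\<And>t. 0 \<le> t \<Longrightarrow> Z (\<lambda>x. t * v x) = poly p t"
      using invariant_valuation_dilation_poly[OF Z v] unfolding n_def by (metis DIM_cart DIM_real mult.right_neutral)
    have "coeff p i = Zs i v" for i
      by (subst l[OF p(1)]) (simp add: coeff_sum Zs_def p(2)[symmetric] mult.commute)
    with p show ?thesis by blast
  qed
  have "homogeneous_of_degree i (Zs i)" for i
    unfolding homogeneous_of_degree_def
  proof (intro ballI allI impI)
    fix v :: "real ^ 'n \<Rightarrow> real" and c :: real
    assume v: "v \<in> Conv" and c: "0 \<le> c"
    obtain p where p: "\<And>t. 0 \<le> t \<Longrightarrow> Z (\<lambda>x. t * v x) = poly p t" "\<And>i. coeff p i = Zs i v"
      using dilation[OF v] by blast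
    obtain q where q: "\<And>t. 0 \<le> t \<Longrightarrow> Z (\<lambda>x. t * (c * v x)) = poly q t"
      "\<And>i. coeff q i = Zs i (\<lambda>x. c * v x)"
      using dilation[OF Conv_cmul[OF c v]] by blast
    \<comment> \<open>Dilating \<open>c * v\<close> by \<open>t\<close> is dilating \<open>v\<close>
      by \<open>t * c\<close>. Comparing coefficients gives the factor \<open>c ^ i\<close>, also
      for \<open>c = 0\<close>.\<close>
    have "q = pcompose p [:0, c:]"
    proof (rule poly_eq_if_eq_naturals)
      fix j :: nat
      have "poly q (of_nat j) = Z (\<lambda>x. (of_nat j * c) * v x)"
        using q(1)[of "of_nat j"] by (simp add: mult.assoc)
      also have "\<dots> = poly p (of_nat j * c)"
        using c by (intro p(1)) simp
      finally show "poly q (of_nat j) = poly (pcompose p [:0, c:]) (of_nat j)"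
        by (simp add: poly_pcompose)
    qed
    then show "Zs i (\<lambda>x. c * v x) = c ^ i * Zs i v"
      using p(2) q(2) by (metis coeff_pcompose_linear)
  qed
  moreover have "Z v = (\<Sum>i = 0..n. Zs i v)" if v: "v \<in> Conv" for v
  proof -
    obtain p where p: "degree p \<le> n" "\<And>t. 0 \<le> t \<Longrightarrow> Z (\<lambda>x. t * v x) = poly p t" "\<And>i. coeff p i = Zs i v"
      using dilation[OF v] by blast
    have "Z v = poly p 1"
      using p(2)[of 1] by simp
    also have "\<dots> = (\<Sum>i\<le>n. coeff p i)"
      using p(1) by (subst poly_altdef) (auto intro!: sum.mono_neutral_left simp: le_degree)
    finally show ?thesis
      by (simp add: p(3) atLeast0AtMost)
  qed
  ultimately show ?thesis
    using Zs unfolding invariant_valuation_def n_def by (intro exI[of _ Zs]) blast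
qed

end
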